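(* Assume the signal--entropy separation assumption and the mild-growth assumption on $K$ (both stated in the context). Let $A\mapsto\hat\sigma_f$ be the $\varepsilon$-node-DP algorithm defined in the context, applied to $A\sim\mathrm{SBM}(\sigma_0)$ with $\sigma_0\in\Sigma_\beta$. There exist absolute constants $c_0,c_1,C_0,C_1>0$ such that the following holds. Put $$B:=C_0\frac{K\log(nK)}{nI},\qquad \eta:=\frac{\varepsilon}{4\Delta_a},\qquad \gamma_0:=\eta-B,$$ and assume $\gamma_0>0$, i.e. $\frac{\varepsilon}{4\Delta_a}>C_0\frac{K\log(nK)}{nI}$. Then for every $0<\alpha<\frac12$, setting $$s^\star=s^\star(\alpha):=\frac{C_1\log(nK)+\log(4/\alpha)}{\gamma_0},$$ one has $$\mathbb E\,r(\sigma_0,\hat\sigma_f)\le \exp\{-(1+o(1))\,\mathrm{Signal}+t^\star s^\star\}+\alpha+e^{-c_0\,\mathrm{Signal}}+e^{-c_1(a+\log n)}.$$ Moreover, if $\eta\ge 2B$ and, for any fixed $c_3>0$, one chooses $\alpha:=\frac{1}{nK}e^{-c_3\varepsilon/2}$, then $$s^\star\lesssim \Delta_a\frac{\log(nK)}{\varepsilon}+\Delta_a,$$ and hence $$\mathbb E\,r(\sigma_0,\hat\sigma_f)\le \exp\Big\{-(1+o(1))\,\mathrm{Signal}+O\Big(\Delta_a\frac{\log(nK)}{\varepsilon}\Big)+O(\Delta_a)\Big\}+\frac{1}{nK}e^{-\Omega(\varepsilon)}+e^{-c_0\,\mathrm{Signal}}+e^{-c_1(a+\log n)}.$$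
   Context: Graphs. $\mathcal G$ is the set of simple undirected graphs on $[n]=\{1,\dots,n\}$, identified with symmetric zero-diagonal matrices $A\in\{0,1\}^{n\times n}$. Write $A\sim_v A'$ (node-adjacent) if $A,A'$ differ only in the incident edges of a single vertex $v$. A randomized mechanism $M$ on $\mathcal G$ is $\varepsilon$-node-DP if $\mathbb P(M(A)\in S)\le e^{\varepsilon}\,\mathbb P(M(A')\in S)$ for all measurable $S$ and all $A\sim_v A'$. Model. $n\ge2$, $K\ge 2$, $\beta\ge 1$, and if $K\ge3$ also $1\le\beta<\sqrt{5/3}$. The parameters $K,a,b,\varepsilon$ may depend on $n$; asymptotic notation is as $n\to\infty$, and logarithms are natural. $\Sigma_\beta$ is the set of $\sigma:[n]\to[K]$ with $\frac{n}{\beta K}\le|\{i:\sigma(i)=k\}|\le\frac{\beta n}{K}$ for all $k\in[K]$. For $\sigma_0\in\Sigma_\beta$ and $n>a>b\ge 0$, $A\sim\mathrm{SBM}(\sigma_0)$ means: the entries $A_{ij}$, $i<j$, are independent with $\mathbb P(A_{ij}=1)=a/n$ if $\sigma_0(i)=\sigma_0(j)$ and $b/n$ otherwise. Constant-SNR standing assumption: there are constants $0<\rho_-\le\rho_+<1$ with $\rho_-\le b/a\le\rho_+$ for all large $n$. "Absolute" and implied constants do not depend on $n$; the regime parameters $\rho_\pm$ and $\beta$ are regarded as fixed. Loss. $r(\sigma,\hat\sigma):=\min_{\pi\in S_K}\frac1n\sum_{i=1}^n\mathbf 1\{\sigma(i)\ne\pi(\hat\sigma(i))\}$, with $S_K$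 the permutations of $[K]$. Information. $I=-2\log\big(\sqrt{\tfrac an\tfrac bn}+\sqrt{(1-\tfrac an)(1-\tfrac bn)}\big)$; $\mathrm{Signal}:=nI/2$ if $K=2$ and $\mathrm{Signal}:=nI/(\beta K)$ if $K\ge3$. Score. $T_A(\sigma)=\sum_{i<j}(A_{ij}-\lambda)\mathbf 1\{\sigma(i)=\sigma(j)\}$, where $t^\star=\frac12\log\frac{a(1-b/n)}{b(1-a/n)}$ and $\lambda=-\frac{w}{t^\star}\log(\frac an e^{-t^\star}+1-\frac an)+\frac{1-w}{t^\star}\log(\frac bn e^{t^\star}+1-\frac bn)$, with $w=1/2$ if $K=2$ and any fixed $w\in[0,1]$ if $K\ge3$. Degree envelope. $\mathcal G_C:=\{A:\max_i\deg_A(i)\le C\max\{a,\log n\}\}$, where $C>0$ is a fixed constant, large enough that $\mathbb P(A\in\mathcal G_C)\ge1-\exp(-10(a+\log n))$ under the SBM for all $n$. $\Delta_a:=2C\max\{a,\log n\}$. Estimator. For $A\in\mathcal G_C$ and $\varepsilon_0:=\varepsilon/2$, the restricted Exponential Mechanism outputs $\sigma\in\Sigma_\beta$ with probability $\exp(\frac{\varepsilon_0}{2\Delta_a}T_A(\sigma))/\sum_{\tau\in\Sigma_\beta}\exp(\frac{\varepsilon_0}{2\Delta_a}T_A(\tau))$. The algorithm $\hat\sigma_f$ is an extension of it to all of $\mathcal G$: a mechanism $\mathcal G\to\Sigma_\beta$ that is $\varepsilon$-node-DP and whose output law at every $A\in\mathcal G_C$ equals that of the restricted mechanism (such an extension exists,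 by a known general extension lemma for differentially private mechanisms on metric spaces). Signal--entropy separation assumption: for a sufficiently large absolute constant $C_s>0$, $\mathrm{Signal}\ge C_s\log(nK)$ for all sufficiently large $n$. Mild-growth assumption: there is an absolute constant $C_{\mathrm{mg}}>0$ with $\log(nK)\ge C_{\mathrm{mg}}K\log K$ for all sufficiently large $n$. *)

theory Defs
  imports "HOL-Probability.Probability" "HOL-Combinatorics.Permutations"
begin

text \<open>A graph on \<open>[n] = {1..n}\<close> is its adjacency matrix, with \<^term>\<open>True\<close> for the entry 1;
  entries with an index outside \<open>[n]\<close> are \<^term>\<open>False\<close>, so that a graph is a unique object.\<close>

type_synonym graph = "nat \<Rightarrow> nat \<Rightarrow> bool"

definition graphs :: "nat \<Rightarrow> graph set" where
  "graphs n = {A. (\<forall>i j. A i j \<longrightarrow> i \<in> {1..n} \<and> j \<in> {1..n}) \<and>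
                  (\<forall>i j. A i j = A j i) \<and> (\<forall>i. \<not> A i i)}"

definition degree :: "nat \<Rightarrow> graph \<Rightarrow> nat \<Rightarrow> nat" where
  "degree n A i = card {j \<in> {1..n}. A i j}"

definition node_adjacent :: "nat \<Rightarrow> graph \<Rightarrow> graph \<Rightarrow> bool" where
  "node_adjacent n A A' \<longleftrightarrow> (\<exists>v\<in>{1..n}. \<forall>i j. i \<noteq> v \<and> j \<noteq> v \<longrightarrow> A i j = A' i j)"

text \<open>The outputs range over a finite set, so every set of outputs is measurable.\<close>

definition node_dp :: "nat \<Rightarrow> real \<Rightarrow> (graph \<Rightarrow> 'o pmf) \<Rightarrow> bool" where
  "node_dp n \<epsilon> M \<longleftrightarrow>
     (\<forall>A\<in>graphs n. \<forall>A'\<in>graphs n. node_adjacent n A A' \<longrightarrow>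
        (\<forall>S. measure_pmf.prob (M A) S \<le> exp \<epsilon> * measure_pmf.prob (M A') S))"

text \<open>Community assignments \<open>[n] \<rightarrow> [K]\<close> are extensional functions, so there are finitely many.\<close>

definition Sigma_bal :: "nat \<Rightarrow> nat \<Rightarrow> real \<Rightarrow> (nat \<Rightarrow> nat) set" where
  "Sigma_bal n K \<beta> =
     {\<sigma> \<in> {1..n} \<rightarrow>\<^sub>E {1..K}. \<forall>k\<in>{1..K}.
        real n / (\<beta> * real K) \<le> real (card {i \<in> {1..n}. \<sigma> i = k}) \<and>
        real (card {i \<in> {1..n}. \<sigma> i = k}) \<le> \<beta> * real n / real K}"

definition pairs :: "nat \<Rightarrow> (nat \<times> nat) set" where
  "pairs n = {(i, j). i \<in> {1..n} \<and> j \<in> {1..n} \<and> i < j}"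

definition sbm :: "nat \<Rightarrow> real \<Rightarrow> real \<Rightarrow> (nat \<Rightarrow> nat) \<Rightarrow> graph pmf" where
  "sbm n a b \<sigma>0 =
     map_pmf (\<lambda>f i j. if i < j then f (i, j) else if j < i then f (j, i) else False)
       (Pi_pmf (pairs n) False
          (\<lambda>(i, j). bernoulli_pmf (if \<sigma>0 i = \<sigma>0 j then a / real n else b / real n)))"

definition loss :: "nat \<Rightarrow> nat \<Rightarrow> (nat \<Rightarrow> nat) \<Rightarrow> (nat \<Rightarrow> nat) \<Rightarrow> real" where
  "loss n K \<sigma> \<sigma>' =
     Min ((\<lambda>\<pi>. 1 / real n * (\<Sum>i\<in>{1..n}. of_bool (\<sigma> i \<noteq> \<pi> (\<sigma>' i)))) ` {\<pi>. \<pi> permutes {1..K}})"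

definition info :: "nat \<Rightarrow> real \<Rightarrow> real \<Rightarrow> real" where
  "info n a b =
     - 2 * ln (sqrt (a / real n * (b / real n)) + sqrt ((1 - a / real n) * (1 - b / real n)))"

definition Signal :: "nat \<Rightarrow> nat \<Rightarrow> real \<Rightarrow> real \<Rightarrow> real \<Rightarrow> real" where
  "Signal n K \<beta> a b =
     (if K = 2 then real n * info n a b / 2 else real n * info n a b / (\<beta> * real K))"

definition tstar :: "nat \<Rightarrow> real \<Rightarrow> real \<Rightarrow> real" where
  "tstar n a b = 1 / 2 * ln (a * (1 - b / real n) / (b * (1 - a / real n)))"

text \<open>The free weight \<open>w\<^sub>0\<close> is only used for \<open>K \<ge> 3\<close>.\<close>

definition weight :: "nat \<Rightarrow> real \<Rightarrow> real" where
  "weight K w0 = (if K = 2 then 1 / 2 else w0)"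

definition lam :: "nat \<Rightarrow> nat \<Rightarrow> real \<Rightarrow> real \<Rightarrow> real \<Rightarrow> real" where
  "lam n K w0 a b = (let t = tstar n a b; w = weight K w0 in
     - (w / t) * ln (a / real n * exp (- t) + 1 - a / real n)
     + (1 - w) / t * ln (b / real n * exp t + 1 - b / real n))"

definition score :: "nat \<Rightarrow> real \<Rightarrow> graph \<Rightarrow> (nat \<Rightarrow> nat) \<Rightarrow> real" where
  "score n l A \<sigma> = (\<Sum>(i, j)\<in>pairs n. (of_bool (A i j) - l) * of_bool (\<sigma> i = \<sigma> j))"

definition envelope :: "nat \<Rightarrow> real \<Rightarrow> real \<Rightarrow> graph set" where
  "envelope n C a = {A \<in> graphs n. \<forall>i\<in>{1..n}. real (degree n A i) \<le> C * max a (ln (real n))}"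

definition Delta :: "nat \<Rightarrow> real \<Rightarrow> real \<Rightarrow> real" where
  "Delta n C a = 2 * C * max a (ln (real n))"

definition restricted_prob ::
  "nat \<Rightarrow> nat \<Rightarrow> real \<Rightarrow> real \<Rightarrow> real \<Rightarrow> real \<Rightarrow> real \<Rightarrow> real \<Rightarrow> graph \<Rightarrow> (nat \<Rightarrow> nat) \<Rightarrow> real" where
  "restricted_prob n K \<beta> C w0 a b \<epsilon> A \<sigma> =
     (let \<epsilon>0 = \<epsilon> / 2;
          wt = (\<lambda>\<tau>. exp (\<epsilon>0 / (2 * Delta n C a) * score n (lam n K w0 a b) A \<tau>))
      in wt \<sigma> / (\<Sum>\<tau>\<in>Sigma_bal n K \<beta>. wt \<tau>))"

text \<open>\<open>M\<close> is an \<open>\<epsilon>\<close>-node-DP extension, to all graphs, of the restricted exponential mechanism.\<close>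

definition is_estimator ::
  "nat \<Rightarrow> nat \<Rightarrow> real \<Rightarrow> real \<Rightarrow> real \<Rightarrow> real \<Rightarrow> real \<Rightarrow> real \<Rightarrow> (graph \<Rightarrow> (nat \<Rightarrow> nat) pmf) \<Rightarrow> bool" where
  "is_estimator n K \<beta> C w0 a b \<epsilon> M \<longleftrightarrow>
     (\<forall>A\<in>graphs n. set_pmf (M A) \<subseteq> Sigma_bal n K \<beta>) \<and>
     node_dp n \<epsilon> M \<and>
     (\<forall>A\<in>envelope n C a. \<forall>\<sigma>\<in>Sigma_bal n K \<beta>.
        pmf (M A) \<sigma> = restricted_prob n K \<beta> C w0 a b \<epsilon> A \<sigma>)"

definition risk :: "nat \<Rightarrow> nat \<Rightarrow> real \<Rightarrow> real \<Rightarrow> (nat \<Rightarrow> nat) \<Rightarrow> (graph \<Rightarrow> (nat \<Rightarrow> nat) pmf) \<Rightarrow> real" where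
  "risk n K a b \<sigma>0 M = measure_pmf.expectation (bind_pmf (sbm n a b \<sigma>0) M) (loss n K \<sigma>0)"

definition Bterm :: "nat \<Rightarrow> nat \<Rightarrow> real \<Rightarrow> real \<Rightarrow> real \<Rightarrow> real" where
  "Bterm n K a b C0 = C0 * (real K * ln (real n * real K) / (real n * info n a b))"

definition eta :: "nat \<Rightarrow> real \<Rightarrow> real \<Rightarrow> real \<Rightarrow> real" where
  "eta n C a \<epsilon> = \<epsilon> / (4 * Delta n C a)"

definition gamma0 :: "nat \<Rightarrow> nat \<Rightarrow> real \<Rightarrow> real \<Rightarrow> real \<Rightarrow> real \<Rightarrow> real \<Rightarrow> real" where
  "gamma0 n K C a b \<epsilon> C0 = eta n C a \<epsilon> - Bterm n K a b C0"

definition sstar ::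
  "nat \<Rightarrow> nat \<Rightarrow> real \<Rightarrow> real \<Rightarrow> real \<Rightarrow> real \<Rightarrow> real \<Rightarrow> real \<Rightarrow> real \<Rightarrow> real" where
  "sstar n K C a b \<epsilon> C0 C1 \<alpha> =
     (C1 * ln (real n * real K) + ln (4 / \<alpha>)) / gamma0 n K C a b \<epsilon> C0"

text \<open>The model parameters \<open>K\<close>, \<open>a\<close>, \<open>b\<close> are now sequences indexed by \<open>n\<close>; the ratio
  \<open>\<rho>m \<le> b/a \<le> \<rho>p\<close> is only imposed for large \<open>n\<close>.\<close>

definition sbm_regime ::
  "real \<Rightarrow> real \<Rightarrow> real \<Rightarrow> (nat \<Rightarrow> nat) \<Rightarrow> (nat \<Rightarrow> real) \<Rightarrow> (nat \<Rightarrow> real) \<Rightarrow> bool" where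
  "sbm_regime \<beta> \<rho>m \<rho>p K a b \<longleftrightarrow>
     (\<forall>n\<ge>2. K n \<ge> 2 \<and> (K n \<ge> 3 \<longrightarrow> \<beta> < sqrt (5 / 3)) \<and>
            real n > a n \<and> a n > b n \<and> b n \<ge> 0) \<and>
     (\<forall>\<^sub>F n in sequentially. \<rho>m \<le> b n / a n \<and> b n / a n \<le> \<rho>p)"

definition envelope_constant ::
  "real \<Rightarrow> (nat \<Rightarrow> nat) \<Rightarrow> (nat \<Rightarrow> real) \<Rightarrow> (nat \<Rightarrow> real) \<Rightarrow> real \<Rightarrow> bool" where
  "envelope_constant \<beta> K a b C \<longleftrightarrow> C > 0 \<and>
     (\<forall>n\<ge>2. \<forall>\<sigma>0\<in>Sigma_bal n (K n) \<beta>.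
        measure_pmf.prob (sbm n (a n) (b n) \<sigma>0) (envelope n C (a n))
          \<ge> 1 - exp (- 10 * (a n + ln (real n))))"

definition signal_entropy_separation ::
  "real \<Rightarrow> (nat \<Rightarrow> nat) \<Rightarrow> (nat \<Rightarrow> real) \<Rightarrow> (nat \<Rightarrow> real) \<Rightarrow> real \<Rightarrow> bool" where
  "signal_entropy_separation \<beta> K a b Cs \<longleftrightarrow>
     (\<forall>\<^sub>F n in sequentially. Signal n (K n) \<beta> (a n) (b n) \<ge> Cs * ln (real n * real (K n)))"

definition mild_growth :: "(nat \<Rightarrow> nat) \<Rightarrow> bool" where
  "mild_growth K \<longleftrightarrow>
     (\<exists>Cmg>0. \<forall>\<^sub>F n in sequentially.
        ln (real n * real (K n)) \<ge> Cmg * (real (K n) * ln (real (K n))))"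

definition admissible ::
  "real \<Rightarrow> real \<Rightarrow> real \<Rightarrow> real \<Rightarrow> (nat \<Rightarrow> nat) \<Rightarrow> (nat \<Rightarrow> real) \<Rightarrow> (nat \<Rightarrow> real) \<Rightarrow> real \<Rightarrow> real \<Rightarrow> bool" where
  "admissible \<beta> \<rho>m \<rho>p Cs K a b C w0 \<longleftrightarrow>
     sbm_regime \<beta> \<rho>m \<rho>p K a b \<and> envelope_constant \<beta> K a b C \<and> w0 \<in> {0..1} \<and>
     signal_entropy_separation \<beta> K a b Cs \<and> mild_growth K"

end

(* The relabellings of sigma0 carry weight K! in the normalising sum, so the error probability of the
   exponential mechanism is at most the sum of exp(theta * (T(tau) - T(sigma0))), for every
   theta <= eta, over the assignments tau that are aligned with sigma0 but different from it. At
   theta = tstar the expectation of a summand is exp(-I * (w * P + (1 - w) * Q)), where P and Q count the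
   pairs on which tau and sigma0 disagree about co-membership; by convexity theta = p * tstar gives at
   least the fraction p of that exponent. Counting P and Q shows that the exponent is of order m * Signal
   for m misclassified vertices, with leading constant 1 for bounded m, which beats the entropy
   m * log(nK) as soon as p * Signal >= C1 * log(nK) + x, leaving the error e * exp(-x).
   If tstar sstar >= Signal, the bound is trivial. Otherwise gamma0 * Signal / tstar > C1 * log(nK) + log(4/alpha),
   so p = min(1, eta/tstar) is admissible, with x = log(4/alpha) if eta <= tstar and x = Signal/2 otherwise.
   In particular one may take the o(1) term to be 0.
   In the second bound Delta_a already dominates Signal, because n * I = O(a) and the envelope constant
   is bounded below by the expected degree. *)

theory Submission
  imports Defs
begin

section \<open>Counting split pairs\<close>

text \<open>For K = 2 the signal n I / 2 carries no factor \<beta>, so for \<beta> > 1 a count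
  through class sizes would be too weak. Instead the two kinds of disagreeing pairs together number
  at least m (n - m), and the weight 1/2 turns exactly this sum into an exponent. For K >= 3 each
  kind alone reaches m n / (\<beta> K) up to m^2, which is why any w in [0,1] is allowed. The
  obstacle is that this count is void once m is comparable to a class size. Beyond that point
  optimality of the label matching has to be exploited, through the confusion matrix; that argument
  rests on \<beta>^2 < 5/3 and loses a factor 12. The loss is affordable: the entropy costs log(nK)
  per error, so a constant fraction of the signal per error pays for it once C_s is large, while the
  target x has to be met only once per competitor and not once per error.\<close>

definition hamming :: "nat \<Rightarrow> (nat \<Rightarrow> nat) \<Rightarrow> (nat \<Rightarrow> nat) \<Rightarrow> nat" where
  "hamming n \<sigma> \<tau> = card {i \<in> {1..n}. \<sigma> i \<noteq> \<tau> i}"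

text \<open>Says that the identity is an optimal matching of labels, so that \<open>hamming\<close>
  divided by n is the loss. The permutation may equally act on the other argument.\<close>

definition aligned :: "nat \<Rightarrow> nat \<Rightarrow> (nat \<Rightarrow> nat) \<Rightarrow> (nat \<Rightarrow> nat) \<Rightarrow> bool" where
  "aligned n K \<sigma> \<tau> \<longleftrightarrow> (\<forall>\<pi>. \<pi> permutes {1..K} \<longrightarrow> hamming n \<sigma> \<tau> \<le> hamming n (\<pi> \<circ> \<sigma>) \<tau>)"

text \<open>Asymmetric on purpose. With \<sigma> the truth,
  \<open>split_pairs n \<sigma> \<tau>\<close> holds the within-community pairs that \<tau>
  separates (the Q of the exponent), and \<open>split_pairs n \<tau> \<sigma>\<close> the
  cross-community pairs that \<tau> merges (the P).\<close>

definition split_pairs :: "nat \<Rightarrow> (nat \<Rightarrow> nat) \<Rightarrow> (nat \<Rightarrow> nat) \<Rightarrow> (nat \<times> nat) set" where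
  "split_pairs n \<sigma> \<tau> = {(i, j) \<in> pairs n. \<sigma> i = \<sigma> j \<and> \<tau> i \<noteq> \<tau> j}"

lemma finite_pairs [simp]: "finite (pairs n)"
  by (rule finite_subset[of _ "{1..n} \<times> {1..n}"]) (auto simp: pairs_def)

lemma finite_split_pairs [simp]: "finite (split_pairs n \<sigma> \<tau>)"
  by (rule finite_subset[OF _ finite_pairs]) (auto simp: split_pairs_def)

lemma hamming_commute: "hamming n \<sigma> \<tau> = hamming n \<tau> \<sigma>"
  unfolding hamming_def by (rule arg_cong[where f = card]) auto

lemma hamming_le: "hamming n \<sigma> \<tau> \<le> n"
proof -
  have "hamming n \<sigma> \<tau> \<le> card {1..n}"
    unfolding hamming_def by (rule card_mono) auto
  then show ?thesis by simp
qed

lemma hamming_relabel: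
  assumes "\<pi> permutes S"
  shows "hamming n (\<pi> \<circ> \<sigma>) (\<pi> \<circ> \<tau>) = hamming n \<sigma> \<tau>"
  unfolding hamming_def using permutes_inj[OF assms] by (simp add: inj_eq)

lemma aligned_commute:
  assumes "aligned n K \<sigma> \<tau>"
  shows "aligned n K \<tau> \<sigma>"
  unfolding aligned_def
proof (intro allI impI)
  fix \<pi> assume \<pi>: "\<pi> permutes {1..K}"
  have "hamming n \<sigma> \<tau> \<le> hamming n (inv \<pi> \<circ> \<sigma>) \<tau>"
    using assms permutes_inv[OF \<pi>] by (auto simp: aligned_def)
  also have "\<dots> = hamming n (\<pi> \<circ> (inv \<pi> \<circ> \<sigma>)) (\<pi> \<circ> \<tau>)"
    by (rule hamming_relabel[OF \<pi>, symmetric])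
  also have "\<pi> \<circ> (inv \<pi> \<circ> \<sigma>) = \<sigma>"
    using permutes_inverses(1)[OF \<pi>] by auto
  finally show "hamming n \<tau> \<sigma> \<le> hamming n (\<pi> \<circ> \<tau>) \<sigma>"
    by (simp only: hamming_commute)
qed

text \<open>A pair with exactly one endpoint in \<open>F\<close> can be oriented in only one way, so
  sorting its endpoints is injective and no factor 2 is lost.\<close>

lemma card_cross_le_card_pairs:
  assumes "F \<subseteq> {1..n}" and sym: "\<And>i j. R i j \<Longrightarrow> R j i"
  shows "card {(i, j) \<in> F \<times> ({1..n} - F). R i j} \<le> card {(i, j) \<in> pairs n. R i j}"
proof (rule card_inj_on_le)
  let ?f = "\<lambda>(i, j). (min i j, max i j)"
  show "inj_on ?f {(i, j) \<in> F \<times> ({1..n} - F). R i j}"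
    by (auto simp: inj_on_def min_def max_def split: if_splits)
  show "?f ` {(i, j) \<in> F \<times> ({1..n} - F). R i j} \<subseteq> {(i, j) \<in> pairs n. R i j}"
    using assms by (fastforce simp: pairs_def min_def max_def intro: le_neq_implies_less)
  show "finite {(i, j) \<in> pairs n. R i j}"
    by (rule finite_subset[OF _ finite_pairs]) auto
qed

lemma card_ordered_le_2_card_split_pairs:
  "card {(i, j) \<in> {1..n} \<times> {1..n}. \<sigma> i = \<sigma> j \<and> \<tau> i \<noteq> \<tau> j} \<le> 2 * card (split_pairs n \<sigma> \<tau>)"
    (is "card ?O \<le> _")
proof -
  have "?O \<subseteq> split_pairs n \<sigma> \<tau> \<union> prod.swap ` split_pairs n \<sigma> \<tau>"
  proof clarify
    fix i j assume *: "(i, j) \<notin> prod.swap ` split_pairs n \<sigma> \<tau>" "i \<in> {1..n}" "j \<in> {1..n}"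
      "\<sigma> i = \<sigma> j" "\<tau> i \<noteq> \<tau> j"
    have "(j, i) \<notin> split_pairs n \<sigma> \<tau>"
      using *(1) by (metis image_eqI swap_simp)
    moreover have "i \<noteq> j" using * by auto
    ultimately show "(i, j) \<in> split_pairs n \<sigma> \<tau>"
      using *(2-) by (auto simp: split_pairs_def pairs_def)
  qed
  then have "card ?O \<le> card (split_pairs n \<sigma> \<tau> \<union> prod.swap ` split_pairs n \<sigma> \<tau>)"
    by (rule card_mono[rotated]) auto
  also have "\<dots> \<le> card (split_pairs n \<sigma> \<tau>) + card (prod.swap ` split_pairs n \<sigma> \<tau>)"
    by (rule card_Un_le)
  also have "\<dots> \<le> 2 * card (split_pairs n \<sigma> \<tau>)"
    using card_image_le[of "split_pairs n \<sigma> \<tau>" prod.swap] by simp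
  finally show ?thesis .
qed

lemma Sigma_bal_range: "\<sigma> \<in> Sigma_bal n K \<beta> \<Longrightarrow> i \<in> {1..n} \<Longrightarrow> \<sigma> i \<in> {1..K}"
  by (auto simp: Sigma_bal_def PiE_def Pi_def)

lemma Sigma_bal_class_ge:
  "\<sigma> \<in> Sigma_bal n K \<beta> \<Longrightarrow> k \<in> {1..K} \<Longrightarrow>
     real n / (\<beta> * real K) \<le> real (card {i \<in> {1..n}. \<sigma> i = k})"
  by (auto simp: Sigma_bal_def)

lemma Sigma_bal_class_le:
  "\<sigma> \<in> Sigma_bal n K \<beta> \<Longrightarrow> k \<in> {1..K} \<Longrightarrow>
     real (card {i \<in> {1..n}. \<sigma> i = k}) \<le> \<beta> * real n / real K"
  by (auto simp: Sigma_bal_def)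

lemma finite_Sigma_bal [simp]: "finite (Sigma_bal n K \<beta>)"
  by (rule finite_subset[of _ "{1..n} \<rightarrow>\<^sub>E {1..K}"]) (auto simp: Sigma_bal_def intro: finite_PiE)

text \<open>A misclassified i and a correctly classified j of the same \<sigma>-class are always
  split, since \<tau> j = \<sigma> j = \<sigma> i \<noteq> \<tau> i. Each error has at least class
  size minus m such partners, and counting only pairs with one endpoint in error keeps the leading
  constant 1.\<close>

lemma split_pairs_ge_few_errors:
  assumes \<sigma>: "\<sigma> \<in> Sigma_bal n K \<beta>"
  shows "real (card (split_pairs n \<sigma> \<tau>)) \<ge>
    real (hamming n \<sigma> \<tau>) * (real n / (\<beta> * real K) - real (hamming n \<sigma> \<tau>))"
proof -
  define F where "F = {i \<in> {1..n}. \<sigma> i \<noteq> \<tau> i}"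
  have F: "F \<subseteq> {1..n}" "finite F" "card F = hamming n \<sigma> \<tau>"
    by (auto simp: F_def hamming_def)
  define G where "G i = {j \<in> {1..n} - F. \<sigma> i = \<sigma> j}" for i
  have G: "real (card (G i)) \<ge> real n / (\<beta> * real K) - real (hamming n \<sigma> \<tau>)" if "i \<in> F" for i
  proof -
    have "\<sigma> i \<in> {1..K}" using that F \<sigma> Sigma_bal_range by blast
    then have "real n / (\<beta> * real K) \<le> real (card {j \<in> {1..n}. \<sigma> j = \<sigma> i})"
      by (rule Sigma_bal_class_ge[OF \<sigma>])
    moreover have "card {j \<in> {1..n}. \<sigma> j = \<sigma> i} \<le> card (G i \<union> F)"
      by (rule card_mono) (auto simp: G_def F(2))
    moreover have "card (G i \<union> F) \<le> card (G i) + card F" by (rule card_Un_le)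
    ultimately show ?thesis using F(3) by linarith
  qed
  have "real (hamming n \<sigma> \<tau>) * (real n / (\<beta> * real K) - real (hamming n \<sigma> \<tau>))
      \<le> (\<Sum>i\<in>F. real (card (G i)))"
    using sum_bounded_below[of F "real n / (\<beta> * real K) - real (hamming n \<sigma> \<tau>)" "\<lambda>i. real (card (G i))"]
      G F(3) by simp
  also have "\<dots> = real (card (Sigma F G))"
    by (subst card_SigmaI) (auto simp: F(2) G_def)
  also have "Sigma F G \<subseteq> {(i, j) \<in> F \<times> ({1..n} - F). \<sigma> i = \<sigma> j \<and> \<tau> i \<noteq> \<tau> j}"
    by (auto simp: G_def F_def)
  then have "card (Sigma F G) \<le> card {(i, j) \<in> F \<times> ({1..n} - F). \<sigma> i = \<sigma> j \<and> \<tau> i \<noteq> \<tau> j}"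
    by (rule card_mono[rotated]) (rule finite_subset[of _ "F \<times> {1..n}"], auto simp: F(2))
  also have "\<dots> \<le> card (split_pairs n \<sigma> \<tau>)"
    unfolding split_pairs_def by (rule card_cross_le_card_pairs[OF F(1)]) auto
  finally show ?thesis by simp
qed

section \<open>Matching labels through the confusion matrix\<close>

lemma extend_inj_to_permutation:
  assumes "finite S" "R \<subseteq> S" "inj_on f R" "f ` R \<subseteq> S"
  shows "\<exists>h. h permutes S \<and> (\<forall>k\<in>R. h k = f k)"
proof -
  have "card (S - R) = card (S - f ` R)"
    using assms by (simp add: card_Diff_subset finite_subset[OF assms(2)] card_image)
  then obtain g where g: "bij_betw g (S - R) (S - f ` R)"
    using finite_same_card_bij[of "S - R" "S - f ` R"] assms(1) by auto
  define h where "h k = (if k \<in> R then f k else if k \<in> S then g k else k)" for k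
  have "bij_betw h R (f ` R)"
    using inj_on_imp_bij_betw[OF assms(3)] by (rule bij_betw_cong[THEN iffD1, rotated]) (auto simp: h_def)
  moreover have "bij_betw h (S - R) (S - f ` R)"
    using g by (rule bij_betw_cong[THEN iffD1, rotated]) (auto simp: h_def)
  ultimately have "bij_betw h (R \<union> (S - R)) (f ` R \<union> (S - f ` R))"
    by (rule bij_betw_combine) auto
  then have "bij_betw h S S"
    using assms(2,4) by (simp add: Un_absorb1)
  then have "h permutes S"
    by (rule bij_imp_permutes) (use assms(2) in \<open>auto simp: h_def\<close>)
  moreover have "\<forall>k\<in>R. h k = f k" by (simp add: h_def)
  ultimately show ?thesis by blast
qed

lemma card_partition_classes:
  assumes "\<And>i. i \<in> {1..n} \<Longrightarrow> \<sigma> i \<in> {1..(K::nat)}"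
  shows "card {i \<in> {1..n::nat}. P i} = (\<Sum>k\<in>{1..K}. card {i \<in> {1..n}. \<sigma> i = k \<and> P i})"
proof -
  have "{i \<in> {1..n}. P i} = (\<Union>k\<in>{1..K}. {i \<in> {1..n}. \<sigma> i = k \<and> P i})"
    using assms by blast
  then show ?thesis
    by (simp only:) (rule card_UN_disjoint, auto)
qed

text \<open>The dominant column of each row of the confusion matrix nearly defines a permutation. A row
  whose dominant column is claimed by a larger entry has its dominant entry bounded by half a column
  sum, hence (as \<open>\<beta>\<^sup>2 < 5/3\<close>) at least a sixth of the row lies off it, so such a row may be
  matched arbitrarily.\<close>

lemma aligned_hamming_le_6_off_dominant:
  assumes \<sigma>: "\<sigma> \<in> Sigma_bal n K \<beta>" and \<tau>: "\<tau> \<in> Sigma_bal n K \<beta>"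
    and al: "aligned n K \<sigma> \<tau>" and \<beta>: "1 \<le> \<beta>" "\<beta>\<^sup>2 < 5 / 3" and K: "K \<ge> 1"
  obtains f where "\<And>k. k \<in> {1..K} \<Longrightarrow> f k \<in> {1..K}"
    "\<And>k l. k \<in> {1..K} \<Longrightarrow> l \<in> {1..K} \<Longrightarrow>
       card {i \<in> {1..n}. \<sigma> i = k \<and> \<tau> i = l} \<le> card {i \<in> {1..n}. \<sigma> i = k \<and> \<tau> i = f k}"
    "hamming n \<sigma> \<tau> \<le> 6 * (\<Sum>k\<in>{1..K}. card {i \<in> {1..n}. \<sigma> i = k \<and> \<tau> i \<noteq> f k})"
proof -
  define N where "N k l = card {i \<in> {1..n}. \<sigma> i = k \<and> \<tau> i = l}" for k l
  define r where "r k = card {i \<in> {1..n}. \<sigma> i = k}" for k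
  have "\<exists>l\<in>{1..K}. \<forall>l'\<in>{1..K}. N k l' \<le> N k l" for k
  proof -
    have "finite (N k ` {1..K})" "N k ` {1..K} \<noteq> {}" using K by auto
    from Max_in[OF this] obtain l where "l \<in> {1..K}" "Max (N k ` {1..K}) = N k l" by auto
    then show ?thesis by (metis Max_ge \<open>finite (N k ` {1..K})\<close> image_eqI)
  qed
  then obtain f where f: "\<And>k. f k \<in> {1..K}" "\<And>k l. l \<in> {1..K} \<Longrightarrow> N k l \<le> N k (f k)"
    by metis
  define D where "D k = card {i \<in> {1..n}. \<sigma> i = k \<and> \<tau> i \<noteq> f k}" for k
  have rD: "r k = N k (f k) + D k" for k
    unfolding r_def N_def D_def by (subst card_Un_disjoint[symmetric]) (auto intro: arg_cong[where f = card])
  \<comment> \<open>Every column that is dominant for some row selects a winner, the row with the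
    largest entry in it. Restricted to the winners \<open>R\<close>, the map \<open>f\<close> is
    injective and hence extends to a permutation \<open>h\<close>.\<close>
  have "\<exists>k. (k \<in> {1..K} \<and> f k = l) \<and> (\<forall>k'\<in>{1..K}. f k' = l \<longrightarrow> N k' l \<le> N k l)" if "l \<in> f ` {1..K}" for l
  proof -
    let ?S = "{k \<in> {1..K}. f k = l}"
    have "finite ((\<lambda>k. N k l) ` ?S)" "(\<lambda>k. N k l) ` ?S \<noteq> {}" using that by auto
    from Max_in[OF this] obtain k where "k \<in> ?S" "Max ((\<lambda>k. N k l) ` ?S) = N k l" by auto
    moreover have "N k' l \<le> Max ((\<lambda>k. N k l) ` ?S)" if "k' \<in> ?S" for k'
      using that by (intro Max_ge) auto
    ultimately show ?thesis by auto
  qed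
  then obtain g where g: "\<And>l. l \<in> f ` {1..K} \<Longrightarrow> g l \<in> {1..K} \<and> f (g l) = l"
    "\<And>l k. l \<in> f ` {1..K} \<Longrightarrow> k \<in> {1..K} \<Longrightarrow> f k = l \<Longrightarrow> N k l \<le> N (g l) l"
    by metis
  define R where "R = g ` f ` {1..K}"
  have R: "R \<subseteq> {1..K}" "inj_on f R" "f ` R \<subseteq> {1..K}"
    using f(1) g(1) by (auto simp: R_def inj_on_def)
  obtain h where h: "h permutes {1..K}" "\<And>k. k \<in> R \<Longrightarrow> h k = f k"
    using extend_inj_to_permutation[OF finite_atLeastAtMost R] by metis
  have unmatched: "r k \<le> 6 * D k" if k: "k \<in> {1..K}" "k \<notin> R" for k
  proof -
    define k' where "k' = g (f k)"
    have k': "k' \<in> {1..K}" "f k' = f k" "N k (f k) \<le> N k' (f k)" "k' \<noteq> k"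
      unfolding k'_def using g(1)[of "f k"] g(2)[of "f k" k] k by (force simp only: R_def)+
    have "N k (f k) + N k' (f k) = card ({i \<in> {1..n}. \<sigma> i = k \<and> \<tau> i = f k} \<union> {i \<in> {1..n}. \<sigma> i = k' \<and> \<tau> i = f k})"
      unfolding N_def using k'(4) by (subst card_Un_disjoint) auto
    also have "\<dots> \<le> card {i \<in> {1..n}. \<tau> i = f k}"
      by (rule card_mono) auto
    finally have "real (2 * N k (f k)) \<le> real (card {i \<in> {1..n}. \<tau> i = f k})"
      using k'(3) by linarith
    also have "\<dots> \<le> \<beta> * real n / real K"
      by (rule Sigma_bal_class_le[OF \<tau> f(1)])
    also have "\<dots> = \<beta>\<^sup>2 * (real n / (\<beta> * real K))"
      using \<beta>(1) by (simp add: power2_eq_square field_simps)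
    also have "\<dots> \<le> 5 / 3 * (real n / (\<beta> * real K))"
      using \<beta> by (intro mult_right_mono) auto
    also have "\<dots> \<le> 5 / 3 * real (r k)"
      using Sigma_bal_class_ge[OF \<sigma> k(1)] by (simp add: r_def)
    finally show ?thesis using rD[of k] by simp
  qed
  \<comment> \<open>Alignment enters here: the identity makes no more errors than the matching
    \<open>h\<close>, whose errors can be counted row by row.\<close>
  have "hamming n \<sigma> \<tau> \<le> hamming n (h \<circ> \<sigma>) \<tau>"
    using al h(1) by (simp add: aligned_def)
  also have "\<dots> = (\<Sum>k\<in>{1..K}. card {i \<in> {1..n}. \<sigma> i = k \<and> (h \<circ> \<sigma>) i \<noteq> \<tau> i})"
    unfolding hamming_def by (rule card_partition_classes) (rule Sigma_bal_range[OF \<sigma>])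
  also have "\<dots> \<le> (\<Sum>k\<in>{1..K}. 6 * D k)"
  proof (rule sum_mono)
    fix k assume k: "k \<in> {1..K}"
    show "card {i \<in> {1..n}. \<sigma> i = k \<and> (h \<circ> \<sigma>) i \<noteq> \<tau> i} \<le> 6 * D k"
    proof (cases "k \<in> R")
      case True
      then have "card {i \<in> {1..n}. \<sigma> i = k \<and> (h \<circ> \<sigma>) i \<noteq> \<tau> i} \<le> D k"
        unfolding D_def using h(2)[OF True] by (intro card_mono) auto
      then show ?thesis by simp
    next
      case False
      have "card {i \<in> {1..n}. \<sigma> i = k \<and> (h \<circ> \<sigma>) i \<noteq> \<tau> i} \<le> r k"
        unfolding r_def by (rule card_mono) auto
      then show ?thesis using unmatched[OF k False] by simp
    qed
  qed
  finally have "hamming n \<sigma> \<tau> \<le> 6 * (\<Sum>k\<in>{1..K}. D k)"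
    by (simp add: sum_distrib_left)
  then show thesis
    using that[of f] f by (auto simp: D_def N_def)
qed

text \<open>Whatever the label \<tau> i is, it occurs in the row of i at most as often as the
  dominant one, so i is split from at least \<open>D (\<sigma> i)\<close> vertices of its class.
  Summing over i weights each \<open>D k\<close> with a row size of at least n / (\<beta> K). The 12
  is the 6 of the matching argument times 2 for ordered pairs.\<close>

lemma split_pairs_ge_many_errors:
  assumes \<sigma>: "\<sigma> \<in> Sigma_bal n K \<beta>" and \<tau>: "\<tau> \<in> Sigma_bal n K \<beta>"
    and al: "aligned n K \<sigma> \<tau>" and \<beta>: "1 \<le> \<beta>" "\<beta>\<^sup>2 < 5 / 3" and K: "K \<ge> 1"
  shows "real (card (split_pairs n \<sigma> \<tau>)) \<ge> real (hamming n \<sigma> \<tau>) * (real n / (\<beta> * real K)) / 12"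
proof -
  obtain f where f: "\<And>k. k \<in> {1..K} \<Longrightarrow> f k \<in> {1..K}"
    "\<And>k l. k \<in> {1..K} \<Longrightarrow> l \<in> {1..K} \<Longrightarrow>
       card {i \<in> {1..n}. \<sigma> i = k \<and> \<tau> i = l} \<le> card {i \<in> {1..n}. \<sigma> i = k \<and> \<tau> i = f k}"
    and m: "hamming n \<sigma> \<tau> \<le> 6 * (\<Sum>k\<in>{1..K}. card {i \<in> {1..n}. \<sigma> i = k \<and> \<tau> i \<noteq> f k})"
    using aligned_hamming_le_6_off_dominant[OF assms] by blast
  define D where "D k = card {i \<in> {1..n}. \<sigma> i = k \<and> \<tau> i \<noteq> f k}" for k
  define s where "s = real n / (\<beta> * real K)"
  have part: "card {j \<in> {1..n}. \<sigma> j = k} =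
      card {j \<in> {1..n}. \<sigma> j = k \<and> \<tau> j = l} + card {j \<in> {1..n}. \<sigma> j = k \<and> \<tau> j \<noteq> l}" for k l
    by (subst card_Un_disjoint[symmetric]) (auto intro: arg_cong[where f = card])
  have DG: "D (\<sigma> i) \<le> card {j \<in> {1..n}. \<sigma> i = \<sigma> j \<and> \<tau> i \<noteq> \<tau> j}" if i: "i \<in> {1..n}" for i
  proof -
    have "card {j \<in> {1..n}. \<sigma> j = \<sigma> i \<and> \<tau> j = \<tau> i} \<le> card {j \<in> {1..n}. \<sigma> j = \<sigma> i \<and> \<tau> j = f (\<sigma> i)}"
      using f(2) i Sigma_bal_range \<sigma> \<tau> by blast
    then have "D (\<sigma> i) \<le> card {j \<in> {1..n}. \<sigma> j = \<sigma> i \<and> \<tau> j \<noteq> \<tau> i}"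
      using part[of "\<sigma> i" "\<tau> i"] part[of "\<sigma> i" "f (\<sigma> i)"] by (simp add: D_def)
    also have "{j \<in> {1..n}. \<sigma> j = \<sigma> i \<and> \<tau> j \<noteq> \<tau> i} = {j \<in> {1..n}. \<sigma> i = \<sigma> j \<and> \<tau> i \<noteq> \<tau> j}"
      by auto
    finally show ?thesis .
  qed
  have "real (hamming n \<sigma> \<tau>) \<le> real (6 * (\<Sum>k\<in>{1..K}. D k))"
    using m unfolding D_def of_nat_le_iff .
  then have "real (hamming n \<sigma> \<tau>) * s / 6 \<le> (\<Sum>k\<in>{1..K}. real (D k)) * s"
    using \<beta>(1) mult_right_mono[of "real (hamming n \<sigma> \<tau>)" "real (6 * (\<Sum>k\<in>{1..K}. D k))" s] by (simp add: s_def)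
  also have "\<dots> \<le> (\<Sum>k\<in>{1..K}. \<Sum>i\<in>{i \<in> {1..n}. \<sigma> i = k}. real (D (\<sigma> i)))"
    unfolding sum_distrib_right
  proof (rule sum_mono)
    fix k assume "k \<in> {1..K}"
    then have "s \<le> real (card {i \<in> {1..n}. \<sigma> i = k})"
      unfolding s_def by (rule Sigma_bal_class_ge[OF \<sigma>])
    then have "real (D k) * s \<le> real (D k) * real (card {i \<in> {1..n}. \<sigma> i = k})"
      by (intro mult_left_mono) auto
    also have "\<dots> = (\<Sum>i\<in>{i \<in> {1..n}. \<sigma> i = k}. real (D (\<sigma> i)))"
      by simp
    finally show "real (D k) * s \<le> (\<Sum>i\<in>{i \<in> {1..n}. \<sigma> i = k}. real (D (\<sigma> i)))" .
  qed
  also have "\<dots> = (\<Sum>i\<in>{1..n}. real (D (\<sigma> i)))"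
    by (rule sum.group) (use Sigma_bal_range[OF \<sigma>] in auto)
  also have "\<dots> \<le> (\<Sum>i\<in>{1..n}. real (card {j \<in> {1..n}. \<sigma> i = \<sigma> j \<and> \<tau> i \<noteq> \<tau> j}))"
    using DG by (intro sum_mono) auto
  also have "\<dots> = real (card (SIGMA i:{1..n}. {j \<in> {1..n}. \<sigma> i = \<sigma> j \<and> \<tau> i \<noteq> \<tau> j}))"
    by (subst card_SigmaI) auto
  also have "(SIGMA i:{1..n}. {j \<in> {1..n}. \<sigma> i = \<sigma> j \<and> \<tau> i \<noteq> \<tau> j}) =
      {(i, j) \<in> {1..n} \<times> {1..n}. \<sigma> i = \<sigma> j \<and> \<tau> i \<noteq> \<tau> j}"
    by auto
  also have "real (card \<dots>) \<le> real (2 * card (split_pairs n \<sigma> \<tau>))"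
    by (intro of_nat_mono card_ordered_le_2_card_split_pairs)
  finally show ?thesis by (simp add: s_def)
qed

section \<open>Two communities\<close>

lemma two_classes_hamming_le_half:
  assumes \<sigma>: "\<sigma> \<in> Sigma_bal n 2 \<beta>" and \<tau>: "\<tau> \<in> Sigma_bal n 2 \<beta>" and al: "aligned n 2 \<sigma> \<tau>"
  shows "2 * hamming n \<sigma> \<tau> \<le> n"
proof -
  let ?\<pi> = "Transposition.transpose 1 (2::nat)"
  have "?\<pi> permutes {1..2}" by (rule permutes_swap_id) auto
  then have le: "hamming n \<sigma> \<tau> \<le> hamming n (?\<pi> \<circ> \<sigma>) \<tau>"
    using al by (simp only: aligned_def)
  have eq: "{i \<in> {1..n}. (?\<pi> \<circ> \<sigma>) i \<noteq> \<tau> i} = {1..n} - {i \<in> {1..n}. \<sigma> i \<noteq> \<tau> i}"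
  proof -
    have "(?\<pi> \<circ> \<sigma>) i \<noteq> \<tau> i \<longleftrightarrow> \<sigma> i = \<tau> i" if "i \<in> {1..n}" for i
    proof -
      have "\<sigma> i = 1 \<or> \<sigma> i = 2" "\<tau> i = 1 \<or> \<tau> i = 2"
        using Sigma_bal_range[OF \<sigma> that] Sigma_bal_range[OF \<tau> that] by auto
      then show ?thesis by auto
    qed
    then show ?thesis by blast
  qed
  have "hamming n (?\<pi> \<circ> \<sigma>) \<tau> = card {1..n} - hamming n \<sigma> \<tau>"
    unfolding hamming_def eq by (rule card_Diff_subset) auto
  with le show ?thesis using hamming_le[of n \<sigma> \<tau>] by simp
qed

text \<open>With two labels, a pair with exactly one endpoint in error necessarily changes its
  co-membership status, in one direction or the other. How these pairs divide between the two
  directions is not controlled, so the estimate concerns the sum, which matches the weight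
  1/2.\<close>

lemma two_classes_split_pairs_ge:
  assumes \<sigma>: "\<sigma> \<in> Sigma_bal n 2 \<beta>" and \<tau>: "\<tau> \<in> Sigma_bal n 2 \<beta>"
  shows "card (split_pairs n \<tau> \<sigma>) + card (split_pairs n \<sigma> \<tau>) \<ge> hamming n \<sigma> \<tau> * (n - hamming n \<sigma> \<tau>)"
proof -
  define F where "F = {i \<in> {1..n}. \<sigma> i \<noteq> \<tau> i}"
  have F: "F \<subseteq> {1..n}" "finite F" "card F = hamming n \<sigma> \<tau>"
    by (auto simp: F_def hamming_def)
  let ?R = "\<lambda>i j. (\<sigma> i = \<sigma> j) \<noteq> (\<tau> i = \<tau> j)"
  have val: "\<sigma> i \<in> {1, 2}" "\<tau> i \<in> {1, 2}" if "i \<in> {1..n}" for i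
    using Sigma_bal_range[OF \<sigma> that] Sigma_bal_range[OF \<tau> that] by auto
  have "F \<times> ({1..n} - F) = {(i, j) \<in> F \<times> ({1..n} - F). ?R i j}"
  proof -
    have "?R i j" if "i \<in> F" "j \<in> {1..n} - F" for i j
      using that val[of i] val[of j] by (auto simp: F_def)
    then show ?thesis by auto
  qed
  then have "card F * (n - card F) = card {(i, j) \<in> F \<times> ({1..n} - F). ?R i j}"
    using F by (metis card_cartesian_product card_Diff_subset card_atLeastAtMost diff_Suc_1)
  also have "\<dots> \<le> card {(i, j) \<in> pairs n. ?R i j}"
    by (rule card_cross_le_card_pairs[OF F(1)]) metis
  also have "{(i, j) \<in> pairs n. ?R i j} = split_pairs n \<tau> \<sigma> \<union> split_pairs n \<sigma> \<tau>"
    by (auto simp: split_pairs_def)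
  also have "card \<dots> \<le> card (split_pairs n \<tau> \<sigma>) + card (split_pairs n \<sigma> \<tau>)"
    by (rule card_Un_le)
  finally show ?thesis by (simp add: F(3))
qed

section \<open>Moments of the score difference\<close>

text \<open>The affinity inside the logarithm is at least sqrt \<rho> / 2: the non-edge term gives
  this for p < 1/2, the edge term with q >= \<rho> p otherwise. For the bound by a, sparse graphs
  satisfy I <= -2 ln(1 - p) <= 4 p, while for p >= 1/2 one has a >= n / 2 and the first bound
  suffices. The first bound absorbs the m^2 I correction, the second compares the signal with
  \<open>Delta\<close>.\<close>

lemma info_bounds:
  assumes ab: "0 < b" "b < a" "a < real n" and \<rho>: "0 < \<rho>" "\<rho> \<le> b / a"
  shows "info n a b \<le> ln (4 / \<rho>)" and "real n * info n a b \<le> (4 + 2 * ln (4 / \<rho>)) * a"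
proof -
  define p where "p = a / real n"
  define q where "q = b / real n"
  have pq: "0 < q" "q < p" "p < 1" "\<rho> * p \<le> q" and a: "a = real n * p"
    using assms by (auto simp: p_def q_def field_simps)
  have "b / a < 1" using ab by simp
  then have "\<rho> < 1" using \<rho> by linarith
  have H: "info n a b = - 2 * ln (sqrt (p * q) + sqrt ((1 - p) * (1 - q)))"
    by (simp add: info_def p_def q_def)
  have low: "sqrt \<rho> / 2 \<le> sqrt (p * q) + sqrt ((1 - p) * (1 - q))"
  proof (cases "p < 1 / 2")
    case True
    have "sqrt \<rho> / 2 \<le> 1 / 2" using \<open>\<rho> < 1\<close> \<rho> by simp
    also have "\<dots> = sqrt ((1 / 2) * (1 / 2))" by (simp only: real_sqrt_abs2)
    also have "\<dots> \<le> sqrt ((1 - p) * (1 - q))"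
      using True pq by (intro real_sqrt_le_mono mult_mono) auto
    also have "\<dots> \<le> sqrt (p * q) + sqrt ((1 - p) * (1 - q))" using pq by simp
    finally show ?thesis .
  next
    case False
    have "sqrt \<rho> / 2 \<le> sqrt \<rho> * p" using False \<rho> by simp
    also have "\<dots> = sqrt (p * (\<rho> * p))" using pq by (simp add: real_sqrt_mult)
    also have "\<dots> \<le> sqrt (p * q)" using pq by (intro real_sqrt_le_mono mult_left_mono) auto
    also have "\<dots> \<le> sqrt (p * q) + sqrt ((1 - p) * (1 - q))" using pq by simp
    finally show ?thesis .
  qed
  have "ln (sqrt \<rho> / 2) \<le> ln (sqrt (p * q) + sqrt ((1 - p) * (1 - q)))"
    using low \<rho> by (intro ln_mono) auto
  moreover have "ln (sqrt \<rho> / 2) = - ln (4 / \<rho>) / 2"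
  proof -
    have "4 = (2::real) ^ 2" by simp
    then have "ln 4 = 2 * ln (2::real)" by (metis ln_realpow of_nat_numeral zero_less_numeral)
    then show ?thesis using \<rho> by (simp add: ln_div ln_sqrt)
  qed
  ultimately show 1: "info n a b \<le> ln (4 / \<rho>)" by (simp add: H)
  have pos: "0 < ln (4 / \<rho>)" using \<rho> \<open>\<rho> < 1\<close> by (intro ln_gt_zero) auto
  have n: "0 < real n" using ab by linarith
  show "real n * info n a b \<le> (4 + 2 * ln (4 / \<rho>)) * a"
  proof (cases "p < 1 / 2")
    case True
    have "1 - p = sqrt ((1 - p) * (1 - p))" using pq by simp
    also have "\<dots> \<le> sqrt ((1 - p) * (1 - q))"
      using pq by (intro real_sqrt_le_mono mult_left_mono) auto
    also have "\<dots> \<le> sqrt (p * q) + sqrt ((1 - p) * (1 - q))" using pq by simp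
    finally have "ln (1 - p) \<le> ln (sqrt (p * q) + sqrt ((1 - p) * (1 - q)))"
      using pq by (intro ln_mono) auto
    moreover have "- ln (1 - p) \<le> 2 * p"
    proof -
      have "- ln (1 - p) = ln (1 / (1 - p))" using pq by (simp add: ln_div)
      also have "\<dots> \<le> 1 / (1 - p) - 1" using pq by (intro ln_le_minus_one) auto
      also have "\<dots> \<le> 2 * p"
      proof -
        have "0 \<le> p * (1 - 2 * p)" using True pq by (intro mult_nonneg_nonneg) auto
        then have "1 \<le> (2 * p + 1) * (1 - p)" by (simp add: algebra_simps)
        then have "1 / (1 - p) \<le> 2 * p + 1" using pq by (simp add: divide_simps)
        then show ?thesis by simp
      qed
      finally show ?thesis .
    qed
    ultimately have "info n a b \<le> 4 * p" unfolding H by linarith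
    also have "\<dots> \<le> (4 + 2 * ln (4 / \<rho>)) * p"
      using pq pos by (intro mult_right_mono) auto
    finally show ?thesis using n by (simp add: a mult.assoc mult.left_commute)
  next
    case False
    have "info n a b \<le> ln (4 / \<rho>) * (2 * p)"
      using 1 False pos mult_left_mono[of 1 "2 * p" "ln (4 / \<rho>)"] by linarith
    also have "\<dots> \<le> (4 + 2 * ln (4 / \<rho>)) * p"
      using pq by (simp add: algebra_simps)
    finally show ?thesis using n by (simp add: a mult.assoc mult.left_commute)
  qed
qed

lemma tstar_pos:
  assumes "0 < b" "b < a" "a < real n"
  shows "0 < tstar n a b"
proof -
  have "b * (1 - a / real n) < a * (1 - b / real n)"
    using assms by (auto simp: field_simps)
  moreover have "0 < b * (1 - a / real n)" using assms by auto
  ultimately show ?thesis unfolding tstar_def by (simp add: less_divide_eq_1)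
qed

text \<open>\<^term>\<open>lam\<close> is the threshold that makes the two exponents \<open>w I\<close> and \<open>(1 - w) I\<close>.\<close>

lemma edge_moments:
  fixes n K :: nat and w0 a b :: real
  assumes ab: "0 < b" "b < a" "a < real n"
  defines "t \<equiv> tstar n a b" and "l \<equiv> lam n K w0 a b" and "w \<equiv> weight K w0"
  shows "b / real n * exp (t * (1 - l)) + (1 - b / real n) * exp (- (t * l)) = exp (- (info n a b * w))"
    and "a / real n * exp (- (t * (1 - l))) + (1 - a / real n) * exp (t * l) = exp (- (info n a b * (1 - w)))"
proof -
  define p where "p = a / real n"
  define q where "q = b / real n"
  have n: "0 < real n" using ab by linarith
  have pq: "0 < q" "q < p" "p < 1"
    using ab by (auto simp: p_def q_def field_simps)
  define z where "z = sqrt (p * q) + sqrt ((1 - p) * (1 - q))"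
  have z: "0 < z"
    unfolding z_def using pq by (intro add_pos_pos) auto
  have I: "info n a b = - 2 * ln z"
    by (simp add: z_def info_def p_def q_def)
  have t: "t = ln (p * (1 - q) / (q * (1 - p))) / 2"
    using n by (simp add: t_def tstar_def p_def q_def)
  have et: "exp t = sqrt p * sqrt (1 - q) / (sqrt q * sqrt (1 - p))"
    using pq by (simp add: t ln_sqrt[symmetric] real_sqrt_mult real_sqrt_divide)
  have eminus: "exp (- t) = sqrt q * sqrt (1 - p) / (sqrt p * sqrt (1 - q))"
    by (simp add: exp_minus et)
  have sq: "p = sqrt p * sqrt p" "q = sqrt q * sqrt q" "1 - p = sqrt (1 - p) * sqrt (1 - p)"
    "1 - q = sqrt (1 - q) * sqrt (1 - q)" using pq by auto
  have pos: "0 < sqrt p" "0 < sqrt q" "0 < sqrt (1 - p)" "0 < sqrt (1 - q)" using pq by auto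
  define Ma where "Ma = p * exp (- t) + 1 - p"
  define Mb where "Mb = q * exp t + 1 - q"
  \<comment> \<open>Both moments \<open>Ma\<close> and \<open>Mb\<close> are instances of this
    identity. Tilting by \<open>t\<close> factors the affinity \<open>z\<close> out of each and
    leaves mutually inverse prefactors, so the product is z^2 and the logarithms add up to
    -I.\<close>
  have alg: "x * x * (y * u / (x * v)) + u * u = u / v * (x * y + u * v)" if "0 < x" "0 < v" for x y u v :: real
    using that by (simp add: field_simps)
  have zz: "z = sqrt p * sqrt q + sqrt (1 - p) * sqrt (1 - q)" "z = sqrt q * sqrt p + sqrt (1 - q) * sqrt (1 - p)"
    by (simp_all add: z_def real_sqrt_mult)
  have "Ma = (sqrt p * sqrt p) * (sqrt q * sqrt (1 - p) / (sqrt p * sqrt (1 - q))) + sqrt (1 - p) * sqrt (1 - p)"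
    unfolding Ma_def eminus using sq by simp
  then have "Ma = sqrt (1 - p) / sqrt (1 - q) * z"
    unfolding zz(1) alg[OF pos(1,4)] .
  moreover
  have "Mb = (sqrt q * sqrt q) * (sqrt p * sqrt (1 - q) / (sqrt q * sqrt (1 - p))) + sqrt (1 - q) * sqrt (1 - q)"
    unfolding Mb_def et using sq by simp
  then have "Mb = sqrt (1 - q) / sqrt (1 - p) * z"
    unfolding zz(2) alg[OF pos(2,3)] .
  ultimately have M: "0 < Ma" "0 < Mb" "ln Ma + ln Mb = - info n a b"
    using pos z by (auto simp: I ln_mult ln_div)
  have t0: "t \<noteq> 0" using tstar_pos[OF ab] by (simp add: t_def)
  have tl: "t * l = - w * ln Ma + (1 - w) * ln Mb"
    unfolding l_def lam_def Let_def w_def[symmetric] t_def[symmetric] p_def[symmetric] q_def[symmetric]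
      Ma_def[symmetric] Mb_def[symmetric] using t0 by (simp add: field_simps)
  have shift: "exp (t * (1 - l)) = exp (- (t * l)) * exp t" "exp (- (t * (1 - l))) = exp (t * l) * exp (- t)"
    by (simp_all add: exp_add[symmetric] algebra_simps)
  have "b / real n * exp (t * (1 - l)) + (1 - b / real n) * exp (- (t * l)) = exp (- (t * l)) * Mb"
    unfolding shift Mb_def q_def by algebra
  also have "\<dots> = exp (ln Mb - t * l)"
    using M by (simp add: exp_diff exp_minus divide_inverse mult.commute)
  also have "ln Mb - t * l = - (info n a b * w)"
    using M(3) unfolding tl by algebra
  finally show "b / real n * exp (t * (1 - l)) + (1 - b / real n) * exp (- (t * l)) = exp (- (info n a b * w))" .
  have "a / real n * exp (- (t * (1 - l))) + (1 - a / real n) * exp (t * l) = exp (t * l) * Ma"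
    unfolding shift Ma_def p_def by algebra
  also have "\<dots> = exp (ln Ma + t * l)"
    using M by (simp add: exp_add)
  also have "ln Ma + t * l = - (info n a b * (1 - w))"
    using M(3) unfolding tl by algebra
  finally show "a / real n * exp (- (t * (1 - l))) + (1 - a / real n) * exp (t * l) = exp (- (info n a b * (1 - w)))" .
qed

section \<open>Exponential moment of the score difference under the block model\<close>

lemma finite_set_sbm [simp]: "finite (set_pmf (sbm n a b \<sigma>))"
proof -
  have "finite (PiE_dflt (pairs n) False (set_pmf \<circ> (\<lambda>(i, j). bernoulli_pmf (if \<sigma> i = \<sigma> j then a / real n else b / real n))))"
    by (rule finite_PiE_dflt) auto
  then show ?thesis by (simp add: sbm_def set_Pi_pmf)
qed

text \<open>The score difference is a sum over independent edges of (A - \<lambda>) s with s in {1,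
  -1, 0}, so the moment factorises exactly. An edge contributes exp(- I w) if \<tau> merges it,
  exp(- I (1 - w)) if \<tau> separates it, and 1 otherwise.\<close>

lemma sbm_score_moment:
  fixes n K :: nat and w0 a b :: real
  assumes ab: "0 < b" "b < a" "a < real n"
  defines "t \<equiv> tstar n a b" and "l \<equiv> lam n K w0 a b" and "w \<equiv> weight K w0"
  shows "measure_pmf.expectation (sbm n a b \<sigma>) (\<lambda>A. exp (t * (score n l A \<tau> - score n l A \<sigma>)))
    = exp (- (info n a b * (w * card (split_pairs n \<tau> \<sigma>) + (1 - w) * card (split_pairs n \<sigma> \<tau>))))"
proof -
  define s :: "nat \<times> nat \<Rightarrow> real" where
    "s e = (case e of (i, j) \<Rightarrow> of_bool (\<tau> i = \<tau> j) - of_bool (\<sigma> i = \<sigma> j))" for e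
  define P where "P = (\<lambda>(i, j). bernoulli_pmf (if \<sigma> i = \<sigma> j then a / real n else b / real n))"
  let ?G = "\<lambda>f i j. if i < j then f (i, j) else if j < i then f (j, i) else False"
  have pr: "0 \<le> a / real n" "a / real n \<le> 1" "0 \<le> b / real n" "b / real n \<le> 1"
    using ab by (auto simp: field_simps)
  have sc: "exp (t * (score n l (?G f) \<tau> - score n l (?G f) \<sigma>))
      = (\<Prod>e\<in>pairs n. exp (t * ((of_bool (f e) - l) * s e)))" for f
  proof -
    have "score n l (?G f) \<tau> - score n l (?G f) \<sigma> = (\<Sum>e\<in>pairs n. (of_bool (f e) - l) * s e)"
      unfolding score_def sum_subtractf[symmetric]
      by (intro sum.cong refl) (auto simp: pairs_def s_def algebra_simps)
    then show ?thesis by (simp add: exp_sum sum_distrib_left)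
  qed
  have card_sum: "(\<Sum>e\<in>pairs n. of_bool (e \<in> split_pairs n \<sigma> \<tau>)) = real (card (split_pairs n \<sigma> \<tau>))" for \<sigma> \<tau>
  proof -
    have "pairs n \<inter> split_pairs n \<sigma> \<tau> = split_pairs n \<sigma> \<tau>" by (auto simp: split_pairs_def)
    then show ?thesis by simp
  qed
  have edge: "measure_pmf.expectation (P e) (\<lambda>v. exp (t * ((of_bool v - l) * s e))) =
     exp (- (info n a b * (w * of_bool (e \<in> split_pairs n \<tau> \<sigma>) + (1 - w) * of_bool (e \<in> split_pairs n \<sigma> \<tau>))))"
    if "e \<in> pairs n" for e
  proof -
    obtain i j where e: "e = (i, j)" by force
    have bern: "measure_pmf.expectation (bernoulli_pmf x) g = x * g True + (1 - x) * g False"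
      if "0 \<le> x" "x \<le> 1" for x and g :: "bool \<Rightarrow> real"
      using that by (simp add: mult.commute)
    have E: "measure_pmf.expectation (bernoulli_pmf (b / real n)) (\<lambda>v. exp (t * (of_bool v - l))) = exp (- (info n a b * w))"
      "measure_pmf.expectation (bernoulli_pmf (a / real n)) (\<lambda>v. exp (t * (l - of_bool v))) = exp (- (info n a b * (1 - w)))"
      using edge_moments[OF ab, where K = K and ?w0.0 = w0, folded t_def l_def w_def]
      by (subst bern; simp add: pr right_diff_distrib)+
    consider "\<tau> i = \<tau> j \<longleftrightarrow> \<sigma> i = \<sigma> j" | "\<tau> i = \<tau> j" "\<sigma> i \<noteq> \<sigma> j" | "\<tau> i \<noteq> \<tau> j" "\<sigma> i = \<sigma> j"
      by blast
    then show ?thesis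
    proof cases
      case 1
      then show ?thesis unfolding e by (auto simp: s_def split_pairs_def)
    next
      case 2
      then have "s e = 1" "P e = bernoulli_pmf (b / real n)" "e \<in> split_pairs n \<tau> \<sigma>" "e \<notin> split_pairs n \<sigma> \<tau>"
        using that unfolding e by (auto simp: s_def split_pairs_def P_def)
      then show ?thesis using E(1) by simp
    next
      case 3
      then have "s e = - 1" "P e = bernoulli_pmf (a / real n)" "e \<notin> split_pairs n \<tau> \<sigma>" "e \<in> split_pairs n \<sigma> \<tau>"
        using that unfolding e by (auto simp: s_def split_pairs_def P_def)
      then show ?thesis using E(2) by simp
    qed
  qed
  have "measure_pmf.expectation (sbm n a b \<sigma>) (\<lambda>A. exp (t * (score n l A \<tau> - score n l A \<sigma>))) =
      measure_pmf.expectation (Pi_pmf (pairs n) False P) (\<lambda>f. \<Prod>e\<in>pairs n. exp (t * ((of_bool (f e) - l) * s e)))"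
    by (simp add: sbm_def P_def[symmetric] sc)
  also have "\<dots> = (\<Prod>e\<in>pairs n. measure_pmf.expectation (P e) (\<lambda>v. exp (t * ((of_bool v - l) * s e))))"
    by (rule expectation_prod_Pi_pmf)
      (auto simp: P_def intro!: integrable_measure_pmf_finite)
  also have "\<dots> = exp (\<Sum>e\<in>pairs n. - (info n a b * (w * of_bool (e \<in> split_pairs n \<tau> \<sigma>)
        + (1 - w) * of_bool (e \<in> split_pairs n \<sigma> \<tau>))))"
    using edge by (simp add: exp_sum)
  also have "(\<Sum>e\<in>pairs n. - (info n a b * (w * of_bool (e \<in> split_pairs n \<tau> \<sigma>)
        + (1 - w) * of_bool (e \<in> split_pairs n \<sigma> \<tau>)))) =
      - (info n a b * (w * (\<Sum>e\<in>pairs n. of_bool (e \<in> split_pairs n \<tau> \<sigma>))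
        + (1 - w) * (\<Sum>e\<in>pairs n. of_bool (e \<in> split_pairs n \<sigma> \<tau>))))"
    by (simp only: sum_negf sum_distrib_left[symmetric] sum.distrib)
  finally show ?thesis unfolding card_sum .
qed

text \<open>Jensen's inequality E Z^p \<le> (E Z)^p for Z = exp (t X), obtained from the pointwise
  bound exp (p y) \<le> 1 - p + p exp y at y = t X + c. The shift by c normalises the mean of exp y
  to at most 1.\<close>

lemma exp_moment_interpolate:
  fixes X :: "'a \<Rightarrow> real"
  assumes fin: "finite (set_pmf D)" and m: "measure_pmf.expectation D (\<lambda>\<omega>. exp (t * X \<omega>)) \<le> exp (- c)"
    and p: "0 \<le> p" "p \<le> 1"
  shows "measure_pmf.expectation D (\<lambda>\<omega>. exp (p * t * X \<omega>)) \<le> exp (- (p * c))"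
proof -
  note int = integrable_measure_pmf_finite[OF fin]
  have "exp (p * t * X \<omega>) * exp (p * c) \<le> (1 - p) + p * (exp (t * X \<omega>) * exp c)" for \<omega>
  proof -
    have "exp ((1 - p) *\<^sub>R 0 + p *\<^sub>R (t * X \<omega> + c)) \<le> (1 - p) * exp 0 + p * exp (t * X \<omega> + c)"
      using convex_onD[OF exp_convex, of p 0 "t * X \<omega> + c"] p by simp
    then show ?thesis by (simp add: exp_add[symmetric] algebra_simps)
  qed
  then have "measure_pmf.expectation D (\<lambda>\<omega>. exp (p * t * X \<omega>) * exp (p * c)) \<le>
      measure_pmf.expectation D (\<lambda>\<omega>. (1 - p) + p * (exp (t * X \<omega>) * exp c))"
    by (intro integral_mono int) auto
  also have "\<dots> = (1 - p) + p * (measure_pmf.expectation D (\<lambda>\<omega>. exp (t * X \<omega>)) * exp c)"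
    by (subst Bochner_Integration.integral_add) (auto intro!: int)
  also have "\<dots> \<le> (1 - p) + p * (exp (- c) * exp c)"
    using m p by (intro add_left_mono mult_left_mono mult_right_mono) auto
  also have "\<dots> = 1" by (simp add: exp_minus)
  finally show ?thesis by (simp add: exp_minus field_simps)
qed

section \<open>The exponential mechanism modulo relabelling\<close>

text \<open>The restriction keeps the result extensional, as membership in \<open>Sigma_bal\<close>
  requires.\<close>

definition relabel :: "nat \<Rightarrow> (nat \<Rightarrow> nat) \<Rightarrow> (nat \<Rightarrow> nat) \<Rightarrow> nat \<Rightarrow> nat" where
  "relabel n \<pi> \<sigma> = restrict (\<pi> \<circ> \<sigma>) {1..n}"

text \<open>Nearest representatives of the wrong orbits. Ties may give one orbit several
  representatives, which is harmless in an upper bound.\<close>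

definition competitors :: "nat \<Rightarrow> nat \<Rightarrow> real \<Rightarrow> (nat \<Rightarrow> nat) \<Rightarrow> (nat \<Rightarrow> nat) set" where
  "competitors n K \<beta> \<sigma> = {\<tau> \<in> Sigma_bal n K \<beta>. aligned n K \<sigma> \<tau> \<and> hamming n \<sigma> \<tau> \<noteq> 0}"

lemma finite_competitors [simp]: "finite (competitors n K \<beta> \<sigma>)"
  by (simp add: competitors_def)

section \<open>The loss and the action of relabelling\<close>

lemma loss_eq_hamming:
  "loss n K \<sigma> \<tau> = Min ((\<lambda>\<pi>. real (hamming n \<sigma> (\<pi> \<circ> \<tau>)) / real n) ` {\<pi>. \<pi> permutes {1..K}})"
proof -
  have "(\<Sum>i\<in>{1..n}. of_bool (\<sigma> i \<noteq> \<pi> (\<tau> i))) = real (hamming n \<sigma> (\<pi> \<circ> \<tau>))" for \<pi>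
    by (simp add: hamming_def Int_def conj_commute)
  then show ?thesis by (simp only: loss_def) simp
qed

lemma loss_nonneg: "0 \<le> loss n K \<sigma> \<tau>"
  unfolding loss_eq_hamming
  by (subst Min_ge_iff) (auto simp: finite_permutations intro!: exI[of _ id] permutes_id)

lemma loss_le:
  assumes "\<pi> permutes {1..K}"
  shows "loss n K \<sigma> \<tau> \<le> real (hamming n \<sigma> (\<pi> \<circ> \<tau>)) / real n"
  unfolding loss_eq_hamming using assms by (intro Min_le) (auto simp: finite_permutations)

lemma loss_le_1: "loss n K \<sigma> \<tau> \<le> 1"
proof -
  have "loss n K \<sigma> \<tau> \<le> real (hamming n \<sigma> (id \<circ> \<tau>)) / real n"
    by (rule loss_le[OF permutes_id])
  also have "\<dots> \<le> 1" using hamming_le[of n \<sigma> "id \<circ> \<tau>"] by (cases "n = 0") (simp_all add: divide_le_eq_1)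
  finally show ?thesis .
qed

lemma hamming_relabel_eq: "hamming n \<sigma> (relabel n \<pi> \<tau>) = hamming n \<sigma> (\<pi> \<circ> \<tau>)"
  unfolding hamming_def relabel_def by (rule arg_cong[where f = card]) auto

lemma score_relabel:
  assumes "\<pi> permutes S"
  shows "score n l A (relabel n \<pi> \<sigma>) = score n l A \<sigma>"
  unfolding score_def relabel_def
  by (intro sum.cong refl) (use permutes_inj[OF assms] in \<open>auto simp: pairs_def inj_eq\<close>)

lemma relabel_in_Sigma_bal:
  assumes \<pi>: "\<pi> permutes {1..K}" and \<sigma>: "\<sigma> \<in> Sigma_bal n K \<beta>"
  shows "relabel n \<pi> \<sigma> \<in> Sigma_bal n K \<beta>"
proof -
  have "{i \<in> {1..n}. relabel n \<pi> \<sigma> i = k} = {i \<in> {1..n}. \<sigma> i = inv \<pi> k}" for k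
    unfolding relabel_def using permutes_inverses[OF \<pi>] by (auto simp del: atLeastAtMost_iff)
  moreover have "inv \<pi> k \<in> {1..K}" if "k \<in> {1..K}" for k
    using that permutes_in_image[OF permutes_inv[OF \<pi>]] by blast
  moreover have "relabel n \<pi> \<sigma> \<in> {1..n} \<rightarrow>\<^sub>E {1..K}"
    unfolding relabel_def using Sigma_bal_range[OF \<sigma>] permutes_in_image[OF \<pi>] by auto
  ultimately show ?thesis
    using \<sigma> unfolding Sigma_bal_def by (simp del: atLeastAtMost_iff)
qed

lemma relabel_inv:
  assumes \<pi>: "\<pi> permutes {1..K}" and \<sigma>: "\<sigma> \<in> Sigma_bal n K \<beta>"
  shows "relabel n (inv \<pi>) (relabel n \<pi> \<sigma>) = \<sigma>"
proof
  fix i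
  have "i \<notin> {1..n} \<Longrightarrow> \<sigma> i = undefined"
    using \<sigma> by (auto simp: Sigma_bal_def)
  then show "relabel n (inv \<pi>) (relabel n \<pi> \<sigma>) i = \<sigma> i"
    by (simp add: relabel_def permutes_inverses[OF \<pi>] del: atLeastAtMost_iff)
qed

lemma Sigma_bal_surj:
  assumes "\<sigma> \<in> Sigma_bal n K \<beta>" "k \<in> {1..K}" "n \<ge> 1" "\<beta> > 0"
  obtains i where "i \<in> {1..n}" "\<sigma> i = k"
proof -
  have "0 < real n / (\<beta> * real K)" using assms by auto
  also have "\<dots> \<le> real (card {i \<in> {1..n}. \<sigma> i = k})"
    by (rule Sigma_bal_class_ge[OF assms(1,2)])
  finally have "{i \<in> {1..n}. \<sigma> i = k} \<noteq> {}" by (metis card.empty of_nat_0 less_irrefl)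
  then show thesis using that by blast
qed

text \<open>The relabelling of \<tau> closest to \<sigma> is aligned, because a permutation acting
  on \<sigma> can be moved to \<tau> as its inverse. It differs from \<sigma>, since otherwise the
  loss would vanish.\<close>

lemma loss_nonzero_competitor:
  assumes \<tau>: "\<tau> \<in> Sigma_bal n K \<beta>" and loss: "loss n K \<sigma> \<tau> \<noteq> 0"
  obtains \<pi> where "\<pi> permutes {1..K}" "relabel n \<pi> \<tau> \<in> competitors n K \<beta> \<sigma>"
proof -
  let ?P = "{\<pi>. \<pi> permutes {1..K}}"
  have "finite ?P" "id \<in> ?P" by (auto simp: finite_permutations permutes_id)
  then obtain \<pi> where \<pi>: "\<pi> permutes {1..K}"
    and min: "\<And>\<rho>. \<rho> permutes {1..K} \<Longrightarrow> hamming n \<sigma> (\<pi> \<circ> \<tau>) \<le> hamming n \<sigma> (\<rho> \<circ> \<tau>)"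
    using arg_min_if_finite[of ?P "\<lambda>\<rho>. hamming n \<sigma> (\<rho> \<circ> \<tau>)"] by (metis empty_iff mem_Collect_eq not_less)
  have "aligned n K \<sigma> (relabel n \<pi> \<tau>)"
    unfolding aligned_def
  proof (intro allI impI)
    fix \<rho> assume \<rho>: "\<rho> permutes {1..K}"
    have "hamming n \<sigma> (relabel n \<pi> \<tau>) \<le> hamming n \<sigma> ((inv \<rho> \<circ> \<pi>) \<circ> \<tau>)"
      unfolding hamming_relabel_eq by (intro min permutes_compose[OF \<pi>] permutes_inv \<rho>)
    also have "\<dots> = hamming n (\<rho> \<circ> \<sigma>) (\<rho> \<circ> ((inv \<rho> \<circ> \<pi>) \<circ> \<tau>))"
      by (rule hamming_relabel[OF \<rho>, symmetric])
    also have "\<rho> \<circ> ((inv \<rho> \<circ> \<pi>) \<circ> \<tau>) = \<pi> \<circ> \<tau>"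
      by (auto simp: permutes_inverses[OF \<rho>])
    finally show "hamming n \<sigma> (relabel n \<pi> \<tau>) \<le> hamming n (\<rho> \<circ> \<sigma>) (relabel n \<pi> \<tau>)"
      by (simp only: hamming_relabel_eq)
  qed
  moreover have "hamming n \<sigma> (relabel n \<pi> \<tau>) \<noteq> 0"
  proof
    assume "hamming n \<sigma> (relabel n \<pi> \<tau>) = 0"
    then have "loss n K \<sigma> \<tau> \<le> 0" using loss_le[OF \<pi>, of n \<sigma> \<tau>] by (simp add: hamming_relabel_eq)
    with loss loss_nonneg[of n K \<sigma> \<tau>] show False by linarith
  qed
  ultimately have "relabel n \<pi> \<tau> \<in> competitors n K \<beta> \<sigma>"
    using relabel_in_Sigma_bal[OF \<pi> \<tau>] by (simp add: competitors_def)
  with \<pi> show thesis by (rule that)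
qed

text \<open>Every orbit under relabelling is at most as large as the orbit of \<open>\<sigma>\<close>, which uses all \<open>K\<close>
  labels; so the number \<open>K!\<close> of relabellings cancels against the normalising sum.\<close>

lemma weight_of_errors_le:
  fixes wt :: "(nat \<Rightarrow> nat) \<Rightarrow> real"
  assumes \<sigma>: "\<sigma> \<in> Sigma_bal n K \<beta>" and n: "n \<ge> 1" "\<beta> > 0"
    and pos: "\<And>\<tau>. 0 < wt \<tau>"
    and inv: "\<And>\<pi> \<tau>. \<pi> permutes {1..K} \<Longrightarrow> wt (relabel n \<pi> \<tau>) = wt \<tau>"
  shows "(\<Sum>\<tau>\<in>{\<tau> \<in> Sigma_bal n K \<beta>. loss n K \<sigma> \<tau> \<noteq> 0}. wt \<tau>) / (\<Sum>\<tau>\<in>Sigma_bal n K \<beta>. wt \<tau>)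
    \<le> (\<Sum>\<tau>\<in>competitors n K \<beta> \<sigma>. wt \<tau> / wt \<sigma>)"
proof -
  let ?P = "{\<pi>. \<pi> permutes {1..K}}"
  let ?c = "real (card ?P)"
  let ?C = "competitors n K \<beta> \<sigma>"
  have fP: "finite ?P" by (simp add: finite_permutations)
  have "{\<tau> \<in> Sigma_bal n K \<beta>. loss n K \<sigma> \<tau> \<noteq> 0} \<subseteq> (\<lambda>(\<pi>, \<tau>). relabel n \<pi> \<tau>) ` (?P \<times> ?C)"
  proof
    fix \<tau> assume "\<tau> \<in> {\<tau> \<in> Sigma_bal n K \<beta>. loss n K \<sigma> \<tau> \<noteq> 0}"
    then have \<tau>: "\<tau> \<in> Sigma_bal n K \<beta>" "loss n K \<sigma> \<tau> \<noteq> 0" by auto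
    obtain \<pi> where \<pi>: "\<pi> permutes {1..K}" "relabel n \<pi> \<tau> \<in> ?C"
      by (rule loss_nonzero_competitor[OF \<tau>])
    then show "\<tau> \<in> (\<lambda>(\<pi>, \<tau>). relabel n \<pi> \<tau>) ` (?P \<times> ?C)"
      using relabel_inv[OF \<pi>(1) \<tau>(1)] permutes_inv[OF \<pi>(1)]
      by (intro image_eqI[of _ _ "(inv \<pi>, relabel n \<pi> \<tau>)"]) auto
  qed
  then have "(\<Sum>\<tau>\<in>{\<tau> \<in> Sigma_bal n K \<beta>. loss n K \<sigma> \<tau> \<noteq> 0}. wt \<tau>)
      \<le> (\<Sum>\<tau>\<in>(\<lambda>(\<pi>, \<tau>). relabel n \<pi> \<tau>) ` (?P \<times> ?C). wt \<tau>)"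
    by (rule sum_mono2[rotated]) (use fP pos in \<open>auto intro: less_imp_le\<close>)
  also have "\<dots> \<le> (\<Sum>(\<pi>, \<tau>)\<in>?P \<times> ?C. wt (relabel n \<pi> \<tau>))"
    using sum_image_le[of "?P \<times> ?C" wt "\<lambda>(\<pi>, \<tau>). relabel n \<pi> \<tau>"] fP less_imp_le[OF pos]
    by (simp add: case_prod_unfold o_def)
  also have "\<dots> = (\<Sum>\<pi>\<in>?P. \<Sum>\<tau>\<in>?C. wt (relabel n \<pi> \<tau>))"
    by (rule sum.cartesian_product[symmetric])
  also have "\<dots> = ?c * (\<Sum>\<tau>\<in>?C. wt \<tau>)"
    by (simp add: inv)
  finally have num: "(\<Sum>\<tau>\<in>{\<tau> \<in> Sigma_bal n K \<beta>. loss n K \<sigma> \<tau> \<noteq> 0}. wt \<tau>) \<le> ?c * (\<Sum>\<tau>\<in>?C. wt \<tau>)" .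
  have inj: "inj_on (\<lambda>\<pi>. relabel n \<pi> \<sigma>) ?P"
  proof (rule inj_onI)
    fix \<pi> \<rho> assume *: "\<pi> \<in> ?P" "\<rho> \<in> ?P" "relabel n \<pi> \<sigma> = relabel n \<rho> \<sigma>"
    show "\<pi> = \<rho>"
    proof
      fix k show "\<pi> k = \<rho> k"
      proof (cases "k \<in> {1..K}")
        case True
        then obtain i where "i \<in> {1..n}" "\<sigma> i = k" using Sigma_bal_surj[OF \<sigma> _ n] by metis
        then show ?thesis using fun_cong[OF *(3), of i] by (simp add: relabel_def)
      next
        case False
        then show ?thesis using * by (simp add: permutes_def)
      qed
    qed
  qed
  have "?c * wt \<sigma> = (\<Sum>\<pi>\<in>?P. wt (relabel n \<pi> \<sigma>))" by (simp add: inv)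
  also have "\<dots> = (\<Sum>\<tau>\<in>(\<lambda>\<pi>. relabel n \<pi> \<sigma>) ` ?P. wt \<tau>)"
    by (subst sum.reindex[OF inj]) (simp add: o_def)
  also have "\<dots> \<le> (\<Sum>\<tau>\<in>Sigma_bal n K \<beta>. wt \<tau>)"
    by (rule sum_mono2) (auto intro: relabel_in_Sigma_bal[OF _ \<sigma>] less_imp_le[OF pos])
  finally have den: "?c * wt \<sigma> \<le> (\<Sum>\<tau>\<in>Sigma_bal n K \<beta>. wt \<tau>)" .
  have "?P \<noteq> {}" using permutes_id[of "{1..K}"] by blast
  then have c: "0 < ?c" using fP unfolding of_nat_0_less_iff card_gt_0_iff by blast
  have "(\<Sum>\<tau>\<in>{\<tau> \<in> Sigma_bal n K \<beta>. loss n K \<sigma> \<tau> \<noteq> 0}. wt \<tau>) / (\<Sum>\<tau>\<in>Sigma_bal n K \<beta>. wt \<tau>)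
      \<le> (?c * (\<Sum>\<tau>\<in>?C. wt \<tau>)) / (?c * wt \<sigma>)"
    by (rule frac_le[OF _ num mult_pos_pos[OF c pos] den]) (auto intro!: sum_nonneg mult_nonneg_nonneg less_imp_le[OF pos])
  also have "\<dots> = (\<Sum>\<tau>\<in>?C. wt \<tau>) / wt \<sigma>" using c by simp
  also have "\<dots> = (\<Sum>\<tau>\<in>?C. wt \<tau> / wt \<sigma>)" by (rule sum_divide_distrib)
  finally show ?thesis .
qed

text \<open>The mechanism itself yields the sum at the rate \<eta> = (\<epsilon>/2) / (2 \<Delta>).
  A smaller rate \<theta> is allowed by a dichotomy: if some competitor outscores \<sigma>, its term
  alone exceeds 1; otherwise all gaps are nonpositive and lowering the rate increases every
  term.\<close>

lemma estimator_error_prob_le: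
  assumes est: "is_estimator n K \<beta> C w0 a b \<epsilon> M" and A: "A \<in> envelope n C a"
    and \<sigma>: "\<sigma> \<in> Sigma_bal n K \<beta>" and n: "n \<ge> 1" "\<beta> > 0"
    and \<theta>: "0 \<le> \<theta>" "\<theta> \<le> eta n C a \<epsilon>"
  shows "measure_pmf.prob (M A) {\<tau>. loss n K \<sigma> \<tau> \<noteq> 0} \<le>
    (\<Sum>\<tau>\<in>competitors n K \<beta> \<sigma>. exp (\<theta> * (score n (lam n K w0 a b) A \<tau> - score n (lam n K w0 a b) A \<sigma>)))"
proof -
  define T where "T = score n (lam n K w0 a b) A"
  define \<eta> where "\<eta> = eta n C a \<epsilon>"
  let ?wt = "\<lambda>\<tau>. exp (\<eta> * T \<tau>)"
  let ?B = "{\<tau> \<in> Sigma_bal n K \<beta>. loss n K \<sigma> \<tau> \<noteq> 0}"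
  have gr: "A \<in> graphs n" using A by (simp add: envelope_def)
  have "\<epsilon> / 2 / (2 * Delta n C a) = \<eta>" by (simp add: \<eta>_def eta_def)
  then have pmf: "pmf (M A) \<tau> = ?wt \<tau> / (\<Sum>\<tau>\<in>Sigma_bal n K \<beta>. ?wt \<tau>)" if "\<tau> \<in> Sigma_bal n K \<beta>" for \<tau>
    using est A that unfolding is_estimator_def restricted_prob_def T_def Let_def by metis
  have "measure_pmf.prob (M A) {\<tau>. loss n K \<sigma> \<tau> \<noteq> 0} = measure_pmf.prob (M A) ?B"
    by (rule measure_pmf.finite_measure_eq_AE)
      (use est gr in \<open>auto simp: is_estimator_def AE_measure_pmf_iff\<close>)
  also have "\<dots> = (\<Sum>\<tau>\<in>?B. pmf (M A) \<tau>)"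
    by (rule measure_measure_pmf_finite) simp
  also have "\<dots> = (\<Sum>\<tau>\<in>?B. ?wt \<tau>) / (\<Sum>\<tau>\<in>Sigma_bal n K \<beta>. ?wt \<tau>)"
    by (simp add: pmf sum_divide_distrib)
  also have "\<dots> \<le> (\<Sum>\<tau>\<in>competitors n K \<beta> \<sigma>. ?wt \<tau> / ?wt \<sigma>)"
    by (rule weight_of_errors_le[OF \<sigma> n]) (auto simp: T_def score_relabel)
  also have "\<dots> = (\<Sum>\<tau>\<in>competitors n K \<beta> \<sigma>. exp (\<eta> * (T \<tau> - T \<sigma>)))"
    by (simp add: exp_diff right_diff_distrib)
  finally have le: "measure_pmf.prob (M A) {\<tau>. loss n K \<sigma> \<tau> \<noteq> 0}
      \<le> (\<Sum>\<tau>\<in>competitors n K \<beta> \<sigma>. exp (\<eta> * (T \<tau> - T \<sigma>)))" .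
  show ?thesis
    unfolding T_def[symmetric]
  proof (cases "\<exists>\<tau>\<in>competitors n K \<beta> \<sigma>. T \<sigma> < T \<tau>")
    case True
    then obtain \<tau> where \<tau>: "\<tau> \<in> competitors n K \<beta> \<sigma>" "T \<sigma> < T \<tau>" by blast
    have "measure_pmf.prob (M A) {\<tau>. loss n K \<sigma> \<tau> \<noteq> 0} \<le> 1" by simp
    also have "1 \<le> exp (\<theta> * (T \<tau> - T \<sigma>))" using \<tau> \<theta> by simp
    also have "\<dots> \<le> (\<Sum>\<tau>\<in>competitors n K \<beta> \<sigma>. exp (\<theta> * (T \<tau> - T \<sigma>)))"
      by (rule member_le_sum[OF \<tau>(1)]) auto
    finally show "measure_pmf.prob (M A) {\<tau>. loss n K \<sigma> \<tau> \<noteq> 0}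
      \<le> (\<Sum>\<tau>\<in>competitors n K \<beta> \<sigma>. exp (\<theta> * (T \<tau> - T \<sigma>)))" .
  next
    case False
    then have "(\<Sum>\<tau>\<in>competitors n K \<beta> \<sigma>. exp (\<eta> * (T \<tau> - T \<sigma>)))
        \<le> (\<Sum>\<tau>\<in>competitors n K \<beta> \<sigma>. exp (\<theta> * (T \<tau> - T \<sigma>)))"
      using \<theta> by (intro sum_mono) (auto simp: \<eta>_def not_less intro!: mult_right_mono_neg)
    with le show "measure_pmf.prob (M A) {\<tau>. loss n K \<sigma> \<tau> \<noteq> 0}
      \<le> (\<Sum>\<tau>\<in>competitors n K \<beta> \<sigma>. exp (\<theta> * (T \<tau> - T \<sigma>)))" by linarith
  qed
qed

text \<open>Replaces the loss by the indicator of its being nonzero, so what is estimated from here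
  on is the probability of failing to recover the communities exactly.\<close>

lemma risk_le_error_prob:
  "risk n K a b \<sigma> M \<le> measure_pmf.expectation (sbm n a b \<sigma>)
     (\<lambda>A. measure_pmf.prob (M A) {\<tau>. loss n K \<sigma> \<tau> \<noteq> 0})"
proof -
  have int: "integrable (measure_pmf D) (loss n K \<sigma>)"
      "integrable (measure_pmf D) (indicator X :: _ \<Rightarrow> real)" for D and X :: "(nat \<Rightarrow> nat) set"
    by (rule measure_pmf.integrable_const_bound[of _ 1]; simp add: loss_nonneg loss_le_1 indicator_def)+
  have "risk n K a b \<sigma> M \<le> measure_pmf.expectation (bind_pmf (sbm n a b \<sigma>) M) (indicator {\<tau>. loss n K \<sigma> \<tau> \<noteq> 0})"
    unfolding risk_def by (intro integral_mono int) (auto simp: indicator_def loss_le_1)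
  also have "\<dots> = measure_pmf.prob (bind_pmf (sbm n a b \<sigma>) M) {\<tau>. loss n K \<sigma> \<tau> \<noteq> 0}"
    by simp
  also have "\<dots> = measure_pmf.expectation (sbm n a b \<sigma>) (\<lambda>A. measure_pmf.prob (M A) {\<tau>. loss n K \<sigma> \<tau> \<noteq> 0})"
    unfolding measure_pmf_bind
    by (rule measure_pmf.measure_bind[where N = "count_space UNIV"]) (auto simp: measure_pmf_in_subprob_algebra)
  finally show ?thesis .
qed

lemma risk_le_1: "risk n K a b \<sigma> M \<le> 1"
proof -
  have "risk n K a b \<sigma> M \<le> measure_pmf.expectation (sbm n a b \<sigma>) (\<lambda>A. 1)"
    by (rule order_trans[OF risk_le_error_prob]) (intro integral_mono integrable_measure_pmf_finite finite_set_sbm, simp)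
  then show ?thesis by simp
qed

text \<open>Interpolating with exponent \<open>p\<close> lets the exponential weights be integrated directly at
  \<open>p * t\<^sup>\<star> \<le> \<eta>\<close>, with no case distinction on the score gap.\<close>

lemma risk_le_moments:
  fixes n K :: nat
  assumes ab: "0 < b" "b < a" "a < real n"
    and est: "is_estimator n K \<beta> C w0 a b \<epsilon> M"
    and \<sigma>: "\<sigma> \<in> Sigma_bal n K \<beta>" and \<beta>: "\<beta> > 0"
    and p: "0 \<le> p" "p \<le> 1" "p * tstar n a b \<le> eta n C a \<epsilon>"
    and env: "measure_pmf.prob (sbm n a b \<sigma>) (envelope n C a) \<ge> 1 - \<delta>"
  shows "risk n K a b \<sigma> M \<le> \<delta> + (\<Sum>\<tau>\<in>competitors n K \<beta> \<sigma>. exp (- (p * (info n a b *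
      (weight K w0 * card (split_pairs n \<tau> \<sigma>) + (1 - weight K w0) * card (split_pairs n \<sigma> \<tau>))))))"
proof -
  let ?D = "sbm n a b \<sigma>" and ?C = "competitors n K \<beta> \<sigma>"
  define X where "X \<tau> A = score n (lam n K w0 a b) A \<tau> - score n (lam n K w0 a b) A \<sigma>" for \<tau> A
  note int = integrable_measure_pmf_finite[OF finite_set_sbm]
  have n: "n \<ge> 1" using ab by (cases n) auto
  have t: "0 \<le> p * tstar n a b" using p tstar_pos[OF ab] by auto
  have "risk n K a b \<sigma> M \<le> measure_pmf.expectation ?D (\<lambda>A. measure_pmf.prob (M A) {\<tau>. loss n K \<sigma> \<tau> \<noteq> 0})"
    by (rule risk_le_error_prob)
  also have "\<dots> \<le> measure_pmf.expectation ?D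
      (\<lambda>A. indicator (- envelope n C a) A + (\<Sum>\<tau>\<in>?C. exp (p * tstar n a b * X \<tau> A)))"
  proof (intro integral_mono int)
    fix A
    have nonneg: "0 \<le> (\<Sum>\<tau>\<in>?C. exp (p * tstar n a b * X \<tau> A))" by (intro sum_nonneg) auto
    show "measure_pmf.prob (M A) {\<tau>. loss n K \<sigma> \<tau> \<noteq> 0} \<le>
        indicator (- envelope n C a) A + (\<Sum>\<tau>\<in>?C. exp (p * tstar n a b * X \<tau> A))"
    proof (cases "A \<in> envelope n C a")
      case True
      then show ?thesis
        using estimator_error_prob_le[OF est True \<sigma> n \<beta> t p(3)] by (simp add: X_def)
    next
      case False
      then show ?thesis
        using nonneg by (simp add: add_increasing2)
    qed
  qed
  also have "\<dots> = measure_pmf.prob ?D (- envelope n C a) +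
      (\<Sum>\<tau>\<in>?C. measure_pmf.expectation ?D (\<lambda>A. exp (p * tstar n a b * X \<tau> A)))"
    by (subst Bochner_Integration.integral_add) (auto intro!: int simp: Bochner_Integration.integral_sum[OF int])
  also have "\<dots> \<le> \<delta> + (\<Sum>\<tau>\<in>?C. exp (- (p * (info n a b *
      (weight K w0 * card (split_pairs n \<tau> \<sigma>) + (1 - weight K w0) * card (split_pairs n \<sigma> \<tau>))))))"
  proof (intro add_mono sum_mono)
    show "measure_pmf.prob ?D (- envelope n C a) \<le> \<delta>"
      using env measure_pmf.prob_compl[of "envelope n C a" ?D] by (simp add: Compl_eq_Diff_UNIV)
    show "measure_pmf.expectation ?D (\<lambda>A. exp (p * tstar n a b * X \<tau> A)) \<le> exp (- (p * (info n a b *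
      (weight K w0 * card (split_pairs n \<tau> \<sigma>) + (1 - weight K w0) * card (split_pairs n \<sigma> \<tau>)))))" for \<tau>
      by (rule exp_moment_interpolate[OF finite_set_sbm _ p(1,2)])
        (simp add: X_def sbm_score_moment[OF ab])
  qed
  finally show ?thesis .
qed

text \<open>The generating function of the Hamming distance factorises over the vertices. With
  weight q = 1 / (n K) per error, each vertex contributes at most 1 + K q = 1 + 1/n, and (1 + 1/n)^n
  \<le> e.\<close>

lemma sum_exp_hamming_le:
  assumes n: "n \<ge> 1" and K: "K \<ge> 1"
  shows "(\<Sum>\<tau>\<in>Sigma_bal n K \<beta>. exp (- (ln (real n * real K) * hamming n \<sigma> \<tau>))) \<le> exp 1"
proof -
  define q where "q = 1 / (real n * real K)"
  have q: "q > 0" "exp (- ln (real n * real K)) = q" using n K by (auto simp: q_def exp_minus inverse_eq_divide)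
  let ?g = "\<lambda>i k. if \<sigma> i \<noteq> k then q else 1"
  have h: "exp (- (ln (real n * real K) * hamming n \<sigma> \<tau>)) = (\<Prod>i\<in>{1..n}. ?g i (\<tau> i))" for \<tau>
  proof -
    have "exp (- (ln (real n * real K) * hamming n \<sigma> \<tau>)) = q ^ hamming n \<sigma> \<tau>"
      by (simp add: q(2)[symmetric] exp_of_nat_mult[symmetric] mult.commute)
    also have "\<dots> = (\<Prod>i\<in>{1..n}. ?g i (\<tau> i))"
      by (subst prod.If_cases) (auto simp: hamming_def Int_def conj_commute)
    finally show ?thesis .
  qed
  have "(\<Sum>\<tau>\<in>Sigma_bal n K \<beta>. exp (- (ln (real n * real K) * hamming n \<sigma> \<tau>)))
      \<le> (\<Sum>\<tau>\<in>{1..n} \<rightarrow>\<^sub>E {1..K}. \<Prod>i\<in>{1..n}. ?g i (\<tau> i))"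
    unfolding h by (rule sum_mono2) (use q in \<open>auto simp: Sigma_bal_def intro!: finite_PiE prod_nonneg\<close>)
  also have "\<dots> = (\<Prod>i\<in>{1..n}. \<Sum>k\<in>{1..K}. ?g i k)"
    by (rule prod_sum_PiE[symmetric]) auto
  also have "\<dots> \<le> (\<Prod>i\<in>{1..n}. exp (1 / real n))"
  proof (rule prod_mono, safe)
    fix i
    show "0 \<le> (\<Sum>k\<in>{1..K}. ?g i k)" using q by (intro sum_nonneg) auto
    have "(\<Sum>k\<in>{1..K}. ?g i k) \<le> (\<Sum>k\<in>{1..K}. q + of_bool (k = \<sigma> i))"
      using q by (intro sum_mono) auto
    also have "\<dots> \<le> real K * q + 1"
      by (simp add: sum.distrib of_bool_def)
    also have "real K * q = 1 / real n" using K by (simp add: q_def)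
    also have "1 / real n + 1 \<le> exp (1 / real n)" using exp_ge_add_one_self[of "1 / real n"] by (simp only: add.commute)
    finally show "(\<Sum>k\<in>{1..K}. ?g i k) \<le> exp (1 / real n)" .
  qed
  also have "\<dots> = exp 1" using n by (simp add: exp_of_nat_mult[symmetric])
  finally show ?thesis .
qed

section \<open>Risk bound\<close>

lemma competitor_exponent_ge:
  assumes n: "n \<ge> 1" and K: "K \<ge> 2" "K \<ge> 3 \<Longrightarrow> \<beta> < sqrt (5 / 3)" and \<beta>: "1 \<le> \<beta>" and w0: "w0 \<in> {0..1}"
    and I: "0 \<le> info n a b"
    and \<sigma>: "\<sigma> \<in> Sigma_bal n K \<beta>" and \<tau>: "\<tau> \<in> competitors n K \<beta> \<sigma>"
  defines "m \<equiv> real (hamming n \<sigma> \<tau>)"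
    and "E \<equiv> info n a b * (weight K w0 * card (split_pairs n \<tau> \<sigma>) + (1 - weight K w0) * card (split_pairs n \<sigma> \<tau>))"
  shows "m * Signal n K \<beta> a b - m\<^sup>2 * info n a b \<le> E" and "m * Signal n K \<beta> a b / 12 \<le> E"
proof -
  have \<tau>': "\<tau> \<in> Sigma_bal n K \<beta>" and al: "aligned n K \<sigma> \<tau>"
    using \<tau> by (auto simp: competitors_def)
  let ?P = "real (card (split_pairs n \<tau> \<sigma>))" and ?Q = "real (card (split_pairs n \<sigma> \<tau>))"
  have mn: "0 \<le> m" by (simp add: m_def)
  have "\<exists>g. Signal n K \<beta> a b = info n a b * g \<and> m * g - m\<^sup>2 \<le> weight K w0 * ?P + (1 - weight K w0) * ?Q
      \<and> m * g / 12 \<le> weight K w0 * ?P + (1 - weight K w0) * ?Q"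
  \<comment> \<open>The witness \<open>g\<close> is the number of disagreeing pairs guaranteed per
    error: n / 2 for two communities and n / (\<beta> K) otherwise, so that the signal is I times
    \<open>g\<close>.\<close>
  proof (cases "K = 2")
    case True
    have "2 * hamming n \<sigma> \<tau> \<le> n"
      using two_classes_hamming_le_half[of \<sigma> n \<beta> \<tau>] \<sigma> \<tau>' al True by simp
    then have m2: "2 * m \<le> real n" by (simp add: m_def)
    have "hamming n \<sigma> \<tau> * (n - hamming n \<sigma> \<tau>) \<le> card (split_pairs n \<tau> \<sigma>) + card (split_pairs n \<sigma> \<tau>)"
      using two_classes_split_pairs_ge[of \<sigma> n \<beta> \<tau>] \<sigma> \<tau>' True by simp
    then have "real (hamming n \<sigma> \<tau> * (n - hamming n \<sigma> \<tau>)) \<le> ?P + ?Q"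
      by (metis of_nat_add of_nat_le_iff)
    then have PQ: "m * (real n - m) \<le> ?P + ?Q"
      by (simp add: m_def of_nat_diff[OF hamming_le])
    have "m * (real n / 2) \<le> m * (real n - m)"
      using m2 mn by (intro mult_left_mono) auto
    with PQ have "m * (real n / 2) / 12 \<le> (?P + ?Q) / 2" using mn by simp
    moreover have "m * (real n / 2) - m\<^sup>2 = m * (real n - m) / 2 - m\<^sup>2 / 2"
      by (simp add: field_simps power2_eq_square)
    then have "m * (real n / 2) - m\<^sup>2 \<le> m * (real n - m) / 2" by simp
    then have "m * (real n / 2) - m\<^sup>2 \<le> (?P + ?Q) / 2"
      by (rule order_trans) (use PQ in simp)
    ultimately show ?thesis
      using True by (intro exI[of _ "real n / 2"]) (simp add: Signal_def weight_def)
  next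
    case False
    define g where "g = real n / (\<beta> * real K)"
    have K3: "K \<ge> 3" using False K by simp
    have \<beta>2: "\<beta>\<^sup>2 < 5 / 3"
      using K(2)[OF K3] \<beta> by (metis abs_of_nonneg order_trans real_sqrt_abs real_sqrt_less_iff zero_le_one)
    have few: "m * g - m\<^sup>2 \<le> ?P" "m * g - m\<^sup>2 \<le> ?Q"
      using split_pairs_ge_few_errors[OF \<tau>', of \<sigma>] split_pairs_ge_few_errors[OF \<sigma>, of \<tau>]
      by (simp_all add: m_def g_def hamming_commute[of n \<tau> \<sigma>] right_diff_distrib power2_eq_square)
    \<comment> \<open>The bound on \<open>?P\<close> is the one on \<open>?Q\<close> with \<sigma>
      and \<tau> exchanged, which is legitimate because alignment is symmetric.\<close>
    have many: "m * g / 12 \<le> ?P" "m * g / 12 \<le> ?Q"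
      using split_pairs_ge_many_errors[OF \<tau>' \<sigma> aligned_commute[OF al] \<beta> \<beta>2]
        split_pairs_ge_many_errors[OF \<sigma> \<tau>' al \<beta> \<beta>2] K3
      by (simp_all add: m_def g_def hamming_commute[of n \<tau> \<sigma>])
    have w: "0 \<le> w0" "0 \<le> 1 - w0" using w0 by auto
    have comb: "x \<le> w0 * ?P + (1 - w0) * ?Q" if "x \<le> ?P" "x \<le> ?Q" for x
      using mult_left_mono[OF that(1) w(1)] mult_left_mono[OF that(2) w(2)] by (simp add: algebra_simps)
    show ?thesis
      using False comb[OF few] comb[OF many]
      by (intro exI[of _ g]) (simp add: Signal_def weight_def g_def)
  qed
  then obtain g where g: "Signal n K \<beta> a b = info n a b * g"
    "m * g - m\<^sup>2 \<le> weight K w0 * ?P + (1 - weight K w0) * ?Q"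
    "m * g / 12 \<le> weight K w0 * ?P + (1 - weight K w0) * ?Q" by blast
  show "m * Signal n K \<beta> a b - m\<^sup>2 * info n a b \<le> E" and "m * Signal n K \<beta> a b / 12 \<le> E"
    using mult_left_mono[OF g(2) I] mult_left_mono[OF g(3) I]
    by (simp_all add: E_def g(1) algebra_simps)
qed

text \<open>For few errors the correction \<open>m\<^sup>2 I\<close> is of order \<open>m\<close> and is absorbed by \<open>C\<^sub>1\<close>; for at least
  twelve errors the crude constant \<open>1/12\<close> already yields the full \<open>x\<close>.\<close>

lemma exponent_beats_entropy:
  fixes S I L J x p m E :: real
  assumes E: "m * S - m\<^sup>2 * I \<le> E" "m * S / 12 \<le> E" and m: "1 \<le> m"
    and p: "0 \<le> p" "p \<le> 1" and I: "0 \<le> I" "I \<le> J" and L: "1 \<le> L" and x: "0 \<le> x"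
    and pS: "(12 + 12 * J) * L + x \<le> p * S"
  shows "x + L * m \<le> p * E"
proof (cases "m < 12")
  case True
  have "p * I \<le> 1 * J" using p I by (intro mult_mono) auto
  then have "m * (p * I) \<le> 12 * J" using True m I p by (intro mult_mono) auto
  moreover have "12 * J * 1 \<le> 12 * J * L" using L I by (intro mult_left_mono) auto
  ultimately have "L + x \<le> p * S - m * (p * I)" using pS L by (simp add: algebra_simps)
  then have "m * (L + x) \<le> m * (p * S - m * (p * I))" using m by (intro mult_left_mono) auto
  also have "\<dots> = p * (m * S - m\<^sup>2 * I)" by (simp add: algebra_simps power2_eq_square)
  also have "\<dots> \<le> p * E" using E(1) p by (intro mult_left_mono) auto
  finally have "m * L + m * x \<le> p * E" by (simp add: algebra_simps)
  moreover have "1 * x \<le> m * x" using m x by (intro mult_right_mono) auto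
  ultimately show ?thesis by (simp add: mult.commute)
next
  case False
  have "0 \<le> J * L" using I L by simp
  then have "12 * L + x \<le> p * S" using pS by (simp add: algebra_simps)
  then have "m / 12 * (12 * L + x) \<le> m / 12 * (p * S)" using m by (intro mult_left_mono) auto
  also have "\<dots> = p * (m * S / 12)" by simp
  also have "\<dots> \<le> p * E" using E(2) p by (intro mult_left_mono) auto
  finally have "m * L + m / 12 * x \<le> p * E" by (simp add: algebra_simps)
  moreover have "1 * x \<le> m / 12 * x" using False x by (intro mult_right_mono) auto
  ultimately show ?thesis by (simp add: mult.commute)
qed

text \<open>Here \<open>p\<close> is the fraction of the tilt \<open>tstar\<close> that the privacy
  budget admits, and \<open>x\<close> the error exponent left after paying ln(nK) per error. Once
  the entropy is paid, summing over all assignments costs only the factor e.\<close>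

lemma risk_le:
  fixes n K :: nat
  assumes ab: "0 < b" "b < a" "a < real n" and \<rho>: "0 < \<rho>" "\<rho> \<le> b / a"
    and K: "K \<ge> 2" "K \<ge> 3 \<Longrightarrow> \<beta> < sqrt (5 / 3)" and n: "n \<ge> 2" and \<beta>: "1 \<le> \<beta>" and w0: "w0 \<in> {0..1}"
    and est: "is_estimator n K \<beta> C w0 a b \<epsilon> M" and \<sigma>: "\<sigma> \<in> Sigma_bal n K \<beta>"
    and p: "0 \<le> p" "p \<le> 1" "p * tstar n a b \<le> eta n C a \<epsilon>"
    and env: "measure_pmf.prob (sbm n a b \<sigma>) (envelope n C a) \<ge> 1 - \<delta>"
    and x: "0 \<le> x" and I: "0 \<le> info n a b" and L: "1 \<le> ln (real n * real K)"
    and pS: "(12 + 12 * ln (4 / \<rho>)) * ln (real n * real K) + x \<le> p * Signal n K \<beta> a b"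
  shows "risk n K a b \<sigma> M \<le> \<delta> + exp 1 * exp (- x)"
proof -
  let ?L = "ln (real n * real K)" and ?C = "competitors n K \<beta> \<sigma>"
  define E where "E \<tau> = info n a b * (weight K w0 * card (split_pairs n \<tau> \<sigma>) + (1 - weight K w0) * card (split_pairs n \<sigma> \<tau>))" for \<tau>
  have "risk n K a b \<sigma> M \<le> \<delta> + (\<Sum>\<tau>\<in>?C. exp (- (p * E \<tau>)))"
    unfolding E_def using \<beta> by (intro risk_le_moments[OF ab est \<sigma> _ p env]) auto
  also have "(\<Sum>\<tau>\<in>?C. exp (- (p * E \<tau>))) \<le> (\<Sum>\<tau>\<in>?C. exp (- x) * exp (- (?L * hamming n \<sigma> \<tau>)))"
  proof (rule sum_mono)
    fix \<tau> assume \<tau>: "\<tau> \<in> ?C"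
    have "1 \<le> real (hamming n \<sigma> \<tau>)" using \<tau> by (simp add: competitors_def)
    moreover have "real (hamming n \<sigma> \<tau>) * Signal n K \<beta> a b - (real (hamming n \<sigma> \<tau>))\<^sup>2 * info n a b \<le> E \<tau>"
      "real (hamming n \<sigma> \<tau>) * Signal n K \<beta> a b / 12 \<le> E \<tau>"
      unfolding E_def using competitor_exponent_ge[OF _ K \<beta> w0 I \<sigma> \<tau>] n by simp_all
    ultimately have "x + ?L * real (hamming n \<sigma> \<tau>) \<le> p * E \<tau>"
      using exponent_beats_entropy[OF _ _ _ p(1,2) I info_bounds(1)[OF ab \<rho>] L x pS] by blast
    then show "exp (- (p * E \<tau>)) \<le> exp (- x) * exp (- (?L * hamming n \<sigma> \<tau>))"
      by (simp add: exp_add[symmetric])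
  qed
  also have "\<dots> \<le> exp (- x) * (\<Sum>\<tau>\<in>Sigma_bal n K \<beta>. exp (- (?L * hamming n \<sigma> \<tau>)))"
    unfolding sum_distrib_left[symmetric]
    by (intro mult_left_mono sum_mono2) (auto simp: competitors_def)
  also have "\<dots> \<le> exp (- x) * exp 1"
    using n K by (intro mult_left_mono sum_exp_hamming_le) auto
  finally show ?thesis by (simp add: mult.commute)
qed

section \<open>A lower bound on the envelope constant\<close>

lemma expected_degree_ge:
  fixes n :: nat
  assumes ab: "0 \<le> b" "b \<le> a" "a \<le> real n" and n: "n \<ge> 2"
  shows "b / 2 \<le> measure_pmf.expectation (sbm n a b \<sigma>) (\<lambda>A. real (degree n A 1))"
proof -
  let ?D = "sbm n a b \<sigma>"
  note int = integrable_measure_pmf_finite[OF finite_set_sbm]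
  have edge: "b / real n \<le> measure_pmf.expectation ?D (\<lambda>A. of_bool (A 1 j))" if j: "j \<in> {2..n}" for j
  proof -
    let ?q = "if \<sigma> 1 = \<sigma> j then a / real n else b / real n"
    have q: "0 \<le> ?q" "?q \<le> 1" using ab n by (auto simp: field_simps)
    let ?p = "\<lambda>(i, j). bernoulli_pmf (if \<sigma> i = \<sigma> j then a / real n else b / real n)"
    have "measure_pmf.expectation ?D (\<lambda>A. of_bool (A 1 j)) =
        measure_pmf.expectation (Pi_pmf (pairs n) False ?p) (\<lambda>f. of_bool (f (1, j)) :: real)"
      using j by (simp add: sbm_def)
    also have "\<dots> = measure_pmf.expectation (map_pmf (\<lambda>f. f (1, j)) (Pi_pmf (pairs n) False ?p)) (of_bool :: bool \<Rightarrow> real)"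
      by simp
    also have "map_pmf (\<lambda>f. f (1, j)) (Pi_pmf (pairs n) False ?p) = bernoulli_pmf ?q"
      using j by (subst Pi_pmf_component[OF finite_pairs]) (auto simp: pairs_def)
    also have "measure_pmf.expectation (bernoulli_pmf ?q) (of_bool :: bool \<Rightarrow> real) = ?q"
      using q by (subst integral_bernoulli_pmf) auto
    finally show ?thesis using ab n by (simp add: divide_right_mono)
  qed
  have "b / 2 \<le> (\<Sum>j\<in>{2..n}. b / real n)"
  proof -
    have "real n / 2 \<le> real (n - 1)" using n by (simp add: of_nat_diff)
    then have "b * (real n / 2) \<le> b * real (n - 1)" using ab by (intro mult_left_mono) auto
    then show ?thesis using n by (simp add: field_simps)
  qed
  also have "\<dots> \<le> (\<Sum>j\<in>{2..n}. measure_pmf.expectation ?D (\<lambda>A. of_bool (A 1 j)))"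
    by (rule sum_mono[OF edge])
  also have "\<dots> = measure_pmf.expectation ?D (\<lambda>A. \<Sum>j\<in>{2..n}. of_bool (A 1 j))"
    by (rule Bochner_Integration.integral_sum[OF int, symmetric])
  also have "\<dots> \<le> measure_pmf.expectation ?D (\<lambda>A. real (degree n A 1))"
  proof (intro integral_mono int)
    fix A :: graph
    have "(\<Sum>j\<in>{2..n}. of_bool (A 1 j)) = real (card {j \<in> {2..n}. A 1 j})"
      by (simp add: Int_def conj_commute)
    also have "card {j \<in> {2..n}. A 1 j} \<le> degree n A 1"
      unfolding degree_def by (rule card_mono) auto
    finally show "(\<Sum>j\<in>{2..n}. of_bool (A 1 j)) \<le> real (degree n A 1)" by simp
  qed
  finally show ?thesis .
qed

text \<open>The expected degree of vertex 1 is at least \<rho> a / 2. The envelope caps this degree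
  at C a, and outside the envelope, an event of probability at most 1/n, the degree is at most n and
  adds at most 1 to the mean. Since 4 \<le> \<rho> a, this 1 is at most \<rho> a / 4.\<close>

lemma envelope_constant_ge:
  fixes n :: nat
  assumes ab: "0 < b" "b < a" "a < real n" and \<rho>: "0 < \<rho>" "\<rho> \<le> b / a" and n: "n \<ge> 2"
    and a: "ln (real n) \<le> a" "4 \<le> \<rho> * a"
    and env: "measure_pmf.prob (sbm n a b \<sigma>) (envelope n C a) \<ge> 1 - exp (- 10 * (a + ln (real n)))"
  shows "\<rho> / 4 \<le> C"
proof -
  let ?D = "sbm n a b \<sigma>"
  note int = integrable_measure_pmf_finite[OF finite_set_sbm]
  have "\<rho> * a / 2 \<le> b / 2" using \<rho> ab by (simp add: field_simps)
  also have "\<dots> \<le> measure_pmf.expectation ?D (\<lambda>A. real (degree n A 1))"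
    using ab n by (intro expected_degree_ge) auto
  also have "\<dots> \<le> measure_pmf.expectation ?D (\<lambda>A. C * a * indicator (envelope n C a) A + real n * indicator (- envelope n C a) A)"
  proof (intro integral_mono int)
    fix A :: graph
    have "degree n A 1 \<le> card {1..n}" unfolding degree_def by (rule card_mono) auto
    then show "real (degree n A 1) \<le> C * a * indicator (envelope n C a) A + real n * indicator (- envelope n C a) A"
      using a n by (cases "A \<in> envelope n C a") (auto simp: envelope_def max_def split: if_splits)
  qed
  also have "\<dots> = C * a * measure_pmf.prob ?D (envelope n C a) + real n * measure_pmf.prob ?D (- envelope n C a)"
    by (subst Bochner_Integration.integral_add) (auto intro!: int)
  finally have 1: "\<rho> * a / 2 \<le> C * a * measure_pmf.prob ?D (envelope n C a) + real n * measure_pmf.prob ?D (- envelope n C a)" .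
  have "measure_pmf.prob ?D (- envelope n C a) \<le> exp (- 10 * (a + ln (real n)))"
    using env measure_pmf.prob_compl[of "envelope n C a" ?D] by (simp add: Compl_eq_Diff_UNIV)
  also have "\<dots> \<le> exp (- ln (real n))"
  proof -
    have "0 \<le> ln (real n)" using n by simp
    then have "ln (real n) \<le> 10 * a + 10 * ln (real n)" using ab by linarith
    then show ?thesis by (simp add: algebra_simps)
  qed
  also have "\<dots> = 1 / real n" using n by (simp add: exp_minus inverse_eq_divide)
  finally have 2: "real n * measure_pmf.prob ?D (- envelope n C a) \<le> 1"
    using n by (simp add: field_simps)
  have "0 < C"
  proof (rule ccontr)
    assume "\<not> 0 < C"
    then have "C * a * measure_pmf.prob ?D (envelope n C a) \<le> 0"
      using ab by (intro mult_nonpos_nonneg) (auto intro: mult_nonpos_nonneg)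
    with 1 2 a show False by linarith
  qed
  then have "C * a * measure_pmf.prob ?D (envelope n C a) \<le> C * a * 1"
    using ab by (intro mult_left_mono) auto
  with 1 2 a have "\<rho> / 4 * a \<le> C * a" by (simp add: field_simps)
  then show ?thesis using ab by simp
qed

section \<open>The private estimator\<close>

text \<open>Two positivity facts come from the asymptotic assumptions: b > 0 because b / a is
  bounded below, and I > 0 because the signal, a positive multiple of I, is at least Cs ln(nK) > 0.
  The bound ln(nK) >= 1 holds as n K >= 4 > e.\<close>

lemma admissible_eventually:
  assumes adm: "admissible \<beta> \<rho>m \<rho>p Cs K a b C w0" and \<rho>: "0 < \<rho>m" and Cs: "0 < Cs" and \<beta>: "1 \<le> \<beta>"
  shows "\<forall>\<^sub>F n in sequentially. n \<ge> 2 \<and> 0 < b n \<and> b n < a n \<and> a n < real n \<and> \<rho>m \<le> b n / a n \<and>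
    K n \<ge> 2 \<and> (K n \<ge> 3 \<longrightarrow> \<beta> < sqrt (5 / 3)) \<and> 1 \<le> ln (real n * real (K n)) \<and>
    Cs * ln (real n * real (K n)) \<le> Signal n (K n) \<beta> (a n) (b n) \<and> 0 \<le> info n (a n) (b n)"
proof -
  have "\<forall>\<^sub>F n in sequentially. \<rho>m \<le> b n / a n \<and> b n / a n \<le> \<rho>p"
    "\<forall>\<^sub>F n in sequentially. Signal n (K n) \<beta> (a n) (b n) \<ge> Cs * ln (real n * real (K n))"
    using adm by (auto simp: admissible_def sbm_regime_def signal_entropy_separation_def)
  then show ?thesis
    using eventually_ge_at_top[of 2]
  proof eventually_elim
    case (elim n)
    then have n: "n \<ge> 2" by simp
    with adm have reg: "K n \<ge> 2" "K n \<ge> 3 \<longrightarrow> \<beta> < sqrt (5 / 3)" "a n < real n" "b n < a n" "0 \<le> b n"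
      by (auto simp: admissible_def sbm_regime_def)
    have b: "0 < b n" using reg elim \<rho> by (cases "b n = 0") auto
    have "1 = ln (exp (1::real))" by simp
    also have "\<dots> \<le> ln 4" using exp_le by (intro ln_mono) auto
    also have "(4::real) \<le> real n * real (K n)" using n reg mult_mono[of 2 "real n" 2 "real (K n)"] by simp
    then have "ln 4 \<le> ln (real n * real (K n))" by (intro ln_mono) auto
    finally have L: "1 \<le> ln (real n * real (K n))" .
    then have "0 < Cs * ln (real n * real (K n))" using Cs by simp
    also have "\<dots> \<le> Signal n (K n) \<beta> (a n) (b n)" using elim by simp
    finally have "0 < Signal n (K n) \<beta> (a n) (b n)" .
    moreover have "0 < \<beta> * real (K n)" using reg \<beta> by auto
    ultimately have "0 < real n * info n (a n) (b n)"
      by (auto simp: Signal_def pos_less_divide_eq split: if_splits)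
    then have "0 < info n (a n) (b n)" by (auto simp: zero_less_mult_iff)
    with n reg elim b L show ?case by auto
  qed
qed

lemma private_risk_le:
  fixes n K :: nat and C1 :: real
  assumes ab: "0 < b" "b < a" "a < real n" and \<rho>: "0 < \<rho>" "\<rho> \<le> b / a"
    and K: "K \<ge> 2" "K \<ge> 3 \<Longrightarrow> \<beta> < sqrt (5 / 3)" and n: "n \<ge> 2" and \<beta>: "1 \<le> \<beta>" and w0: "w0 \<in> {0..1}"
    and est: "is_estimator n K \<beta> C w0 a b \<epsilon> M" and \<sigma>: "\<sigma> \<in> Sigma_bal n K \<beta>"
    and env: "measure_pmf.prob (sbm n a b \<sigma>) (envelope n C a) \<ge> 1 - \<delta>"
    and I: "0 \<le> info n a b" and L: "1 \<le> ln (real n * real K)"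
    and \<alpha>: "0 < \<alpha>" "\<alpha> < 1" and \<gamma>: "0 < gamma0 n K C a b \<epsilon> 1"
    and C1: "C1 = 12 + 12 * ln (4 / \<rho>)" "12 \<le> C1" and S: "2 * C1 * ln (real n * real K) \<le> Signal n K \<beta> a b"
  shows "risk n K a b \<sigma> M \<le> exp (- Signal n K \<beta> a b + tstar n a b * sstar n K C a b \<epsilon> 1 C1 \<alpha>) + \<alpha>
    + exp (- (1 / 4) * Signal n K \<beta> a b) + \<delta>"
proof -
  define S where "S = Signal n K \<beta> a b"
  define l where "l = ln (real n * real K)"
  define t where "t = tstar n a b"
  define g where "g = gamma0 n K C a b \<epsilon> 1"
  define \<eta> where "\<eta> = eta n C a \<epsilon>"
  define x where "x = ln (4 / \<alpha>)"
  have t: "0 < t" unfolding t_def by (rule tstar_pos[OF ab])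
  have g: "0 < g" using \<gamma> by (simp add: g_def)
  \<comment> \<open>As B is nonnegative, a rate permitted by \<gamma>0 is permitted by \<eta>; this
    is why C0 = 1 suffices.\<close>
  have "0 \<le> Bterm n K a b 1" using I L n by (simp add: Bterm_def)
  then have g\<eta>: "g \<le> \<eta>" by (simp add: g_def \<eta>_def gamma0_def)
  have s: "sstar n K C a b \<epsilon> 1 C1 \<alpha> = (C1 * l + x) / g"
    by (simp add: sstar_def l_def x_def g_def)
  have x: "0 \<le> x" using \<alpha> by (simp add: x_def)
  have \<delta>: "0 \<le> \<delta>" using env measure_pmf.prob_le_1[of "sbm n a b \<sigma>" "envelope n C a"] by linarith
  have l: "1 \<le> l" using L by (simp add: l_def)
  have S4: "4 \<le> S"
  proof -
    have "4 \<le> 2 * C1 * l" using mult_mono[of 4 "2 * C1" 1 l] C1(2) l by simp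
    then show ?thesis using S by (simp add: S_def l_def)
  qed
  have "exp (1::real) \<le> 4" using exp_le by linarith
  \<comment> \<open>Each regime is responsible for one term of the bound: the privacy cost outweighs
    the signal (first exponential), the budget caps the tilt below \<open>tstar\<close> (the term
    \<alpha>), or the full tilt is affordable (the term exp (- S / 4)).\<close>
  consider "S \<le> t * ((C1 * l + x) / g)" | "t * ((C1 * l + x) / g) < S" "\<eta> \<le> t" | "t < \<eta>"
    by linarith
  then have "risk n K a b \<sigma> M \<le> exp (- S + t * ((C1 * l + x) / g)) + \<alpha> + exp (- (1 / 4) * S) + \<delta>"
  proof cases
    case 1
    have "risk n K a b \<sigma> M \<le> 1" by (rule risk_le_1)
    also have "1 \<le> exp (- S + t * ((C1 * l + x) / g))" using 1 by simp
    also have "\<dots> \<le> exp (- S + t * ((C1 * l + x) / g)) + \<alpha> + exp (- (1 / 4) * S) + \<delta>"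
      using \<alpha> \<delta> by simp
    finally show ?thesis .
  next
    case 2
    have "C1 * l + x \<le> g * S / t" using 2 t g by (simp add: field_simps)
    also have "\<dots> \<le> \<eta> * S / t" using g\<eta> S4 t by (intro divide_right_mono mult_right_mono) auto
    finally have "C1 * l + x \<le> \<eta> / t * S" by simp
    then have "risk n K a b \<sigma> M \<le> \<delta> + exp 1 * exp (- x)"
      using 2 t g g\<eta> I L x C1 unfolding S_def l_def t_def \<eta>_def
      by (intro risk_le[OF ab \<rho> K n \<beta> w0 est \<sigma> _ _ _ env, where p = "\<eta> / t"]) (auto simp: \<eta>_def t_def)
    \<comment> \<open>The 4 in log(4/\<alpha>) absorbs the entropy factor e.\<close>
    also have "exp (- x) = \<alpha> / 4" using \<alpha> by (simp add: x_def exp_minus)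
    also have "exp 1 * (\<alpha> / 4) \<le> 4 * (\<alpha> / 4)" using \<alpha> \<open>exp 1 \<le> 4\<close> by (intro mult_right_mono) auto
    finally show ?thesis using exp_ge_zero[of "- S + t * ((C1 * l + x) / g)"] exp_ge_zero[of "- (1 / 4) * S"] by linarith
  next
    case 3
    \<comment> \<open>Half of the signal pays for the entropy and the other half is kept as
      \<open>x\<close>. Because S >= 4, the factor e then costs another S / 4, which leaves the
      constant c0 = 1/4.\<close>
    have "C1 * l + S / 2 \<le> 1 * S" using S by (simp add: S_def l_def)
    then have "risk n K a b \<sigma> M \<le> \<delta> + exp 1 * exp (- (S / 2))"
      using 3 I L S4 C1 unfolding S_def l_def t_def \<eta>_def
      by (intro risk_le[OF ab \<rho> K n \<beta> w0 est \<sigma> _ _ _ env, where p = 1]) auto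
    also have "exp 1 * exp (- (S / 2)) \<le> exp (- (1 / 4) * S)"
      using S4 by (simp add: exp_add[symmetric])
    finally show ?thesis using \<alpha> exp_ge_zero[of "- S + t * ((C1 * l + x) / g)"] by linarith
  qed
  then show ?thesis by (simp add: S_def t_def s)
qed

text \<open>From \<eta> >= 2 B one gets \<gamma>0 >= \<eta> / 2 = \<epsilon> / (8 \<Delta>). For
  this \<alpha>, log(4/\<alpha>) equals ln 4 + ln(nK) + c3 \<epsilon> / 2; the part linear in
  \<epsilon> cancels against the denominator and becomes the bare multiple of \<Delta>.\<close>

lemma sstar_le:
  fixes n K :: nat
  assumes \<gamma>: "0 < gamma0 n K C a b \<epsilon> 1" and \<eta>: "eta n C a \<epsilon> \<ge> 2 * Bterm n K a b 1" and B: "0 \<le> Bterm n K a b 1"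
    and \<Delta>: "0 < Delta n C a" and L: "1 \<le> ln (real n * real K)" and c: "0 < C1" "0 < c3" and nK: "n \<ge> 2" "K \<ge> 2"
  shows "0 < \<epsilon>" and "sstar n K C a b \<epsilon> 1 C1 (1 / (real n * real K) * exp (- c3 * \<epsilon> / 2))
    \<le> (8 * (C1 + 4) + 4 * c3) * (Delta n C a * (ln (real n * real K) / \<epsilon>) + Delta n C a)"
proof -
  define D where "D = Delta n C a"
  define l where "l = ln (real n * real K)"
  have D: "0 < D" using \<Delta> by (simp add: D_def)
  have "0 < eta n C a \<epsilon>" using \<gamma> B by (simp add: gamma0_def)
  then show \<epsilon>: "0 < \<epsilon>" using \<Delta> by (simp add: eta_def zero_less_divide_iff)
  have g: "\<epsilon> / (8 * D) \<le> gamma0 n K C a b \<epsilon> 1"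
    using \<eta> by (simp add: gamma0_def eta_def D_def)
  have "ln (4 / (1 / (real n * real K) * exp (- c3 * \<epsilon> / 2))) = ln (4 * (real n * real K) * exp (c3 * \<epsilon> / 2))"
    by (simp add: exp_minus field_simps)
  also have "\<dots> = ln 4 + l + c3 * \<epsilon> / 2"
    using nK by (simp add: l_def ln_mult)
  also have "ln 4 \<le> 3 * l" using ln_le_minus_one[of 4] L by (simp add: l_def)
  finally have "C1 * l + ln (4 / (1 / (real n * real K) * exp (- c3 * \<epsilon> / 2))) \<le> (C1 + 4) * l + c3 * \<epsilon> / 2"
    by (simp add: algebra_simps)
  then have "sstar n K C a b \<epsilon> 1 C1 (1 / (real n * real K) * exp (- c3 * \<epsilon> / 2))
      \<le> ((C1 + 4) * l + c3 * \<epsilon> / 2) / (\<epsilon> / (8 * D))"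
    unfolding sstar_def l_def[symmetric]
    using g \<epsilon> D c L by (intro frac_le) (auto simp: l_def)
  also have "\<dots> = 8 * (C1 + 4) * (D * (l / \<epsilon>)) + 4 * c3 * D"
    using \<epsilon> D by (simp add: field_simps)
  also have "\<dots> \<le> (8 * (C1 + 4) + 4 * c3) * (D * (l / \<epsilon>)) + (8 * (C1 + 4) + 4 * c3) * D"
    using \<epsilon> D c L by (intro add_mono mult_right_mono) (auto simp: l_def)
  finally show "sstar n K C a b \<epsilon> 1 C1 (1 / (real n * real K) * exp (- c3 * \<epsilon> / 2))
    \<le> (8 * (C1 + 4) + 4 * c3) * (Delta n C a * (ln (real n * real K) / \<epsilon>) + Delta n C a)"
    by (simp add: D_def l_def distrib_left)
qed

text \<open>Since \<open>n I = O(a)\<close> and the envelope constant is bounded below, \<open>\<Delta>\<^sub>a\<close> dominates the signal.\<close>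

lemma Signal_le_Delta:
  fixes n K :: nat
  assumes ab: "0 < b" "b < a" "a < real n" and \<rho>: "0 < \<rho>" "\<rho> \<le> b / a"
    and K: "K \<ge> 2" and n: "n \<ge> 2" and \<beta>: "1 \<le> \<beta>" and I: "0 \<le> info n a b" and L: "1 \<le> ln (real n * real K)"
    and env: "measure_pmf.prob (sbm n a b \<sigma>) (envelope n C a) \<ge> 1 - exp (- 10 * (a + ln (real n)))"
    and S: "4 * (4 + 2 * ln (4 / \<rho>)) / \<rho> * ln (real n * real K) \<le> Signal n K \<beta> a b"
  shows "Signal n K \<beta> a b \<le> (4 + 2 * ln (4 / \<rho>)) / \<rho> * Delta n C a"
proof -
  define H where "H = 4 + 2 * ln (4 / \<rho>)"
  define l where "l = ln (real n * real K)"
  have "b / a < 1" using ab by simp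
  then have \<rho>1: "\<rho> < 1" using \<rho> by linarith
  have H: "4 \<le> H" using \<rho> \<rho>1 by (simp add: H_def)
  have "2 \<le> \<beta> * real K" using K \<beta> mult_mono[of 1 \<beta> 2 "real K"] by simp
  then have "real n * info n a b / (\<beta> * real K) \<le> real n * info n a b / 2"
    using I by (intro divide_left_mono) auto
  then have "Signal n K \<beta> a b \<le> real n * info n a b / 2"
    by (simp add: Signal_def)
  also have "\<dots> \<le> H * a / 2"
    using info_bounds(2)[OF ab \<rho>] by (simp add: H_def)
  finally have SH: "Signal n K \<beta> a b \<le> H * a / 2" .
  \<comment> \<open>Separation from below and n I = O(a) from above squeeze the signal and force a
    >= 4 ln(nK) / \<rho>. So the maximum in \<open>Delta\<close> is a, and the lower bound on C
    becomes applicable.\<close>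
  have "H * (4 * l) \<le> H * (\<rho> * a)"
  proof -
    have "4 * H / \<rho> * l \<le> H * a"
      using S SH ab H mult_nonneg_nonneg[of H a] unfolding H_def[symmetric] l_def[symmetric] by linarith
    then show ?thesis using \<rho> by (simp add: field_simps)
  qed
  then have al: "4 * l \<le> \<rho> * a" using H by simp
  have "ln (real n) \<le> l" unfolding l_def using n K by (intro ln_mono) auto
  moreover have "\<rho> * a \<le> 1 * a" using \<rho>1 ab by (intro mult_right_mono) auto
  ultimately have a: "ln (real n) \<le> a" "4 \<le> \<rho> * a" using al L by (auto simp: l_def)
  have "\<rho> / 4 \<le> C" by (rule envelope_constant_ge[OF ab \<rho> n a env])
  then have "\<rho> / 4 * a \<le> C * a" using ab by (intro mult_right_mono) auto
  then have "\<rho> * a / 2 \<le> Delta n C a" using a by (simp add: Delta_def max_def)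
  then have "H / \<rho> * (\<rho> * a / 2) \<le> H / \<rho> * Delta n C a" using H \<rho> by (intro mult_left_mono) auto
  moreover have "H / \<rho> * (\<rho> * a / 2) = H * a / 2" using \<rho> by simp
  ultimately show ?thesis using SH by (simp add: H_def)
qed

theorem theorem3p5:
  fixes \<beta> \<rho>m \<rho>p :: real
  assumes "1 \<le> \<beta>" and "0 < \<rho>m" and "\<rho>m \<le> \<rho>p" and "\<rho>p < 1"
  shows "\<exists>Cs>0. \<exists>c0>0. \<exists>c1>0. \<exists>C0>0. \<exists>C1>0.
    (\<forall>K a b \<epsilon> C w0. admissible \<beta> \<rho>m \<rho>p Cs K a b C w0 \<longrightarrow>
      (\<exists>\<delta>. \<delta> \<longlonglongrightarrow> 0 \<and>
        (\<forall>\<^sub>F n in sequentially.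
          gamma0 n (K n) C (a n) (b n) (\<epsilon> n) C0 > 0 \<longrightarrow>
          (\<forall>\<sigma>0\<in>Sigma_bal n (K n) \<beta>. \<forall>M.
            is_estimator n (K n) \<beta> C w0 (a n) (b n) (\<epsilon> n) M \<longrightarrow>
            (\<forall>\<alpha>. 0 < \<alpha> \<and> \<alpha> < 1 / 2 \<longrightarrow>
              risk n (K n) (a n) (b n) \<sigma>0 M
              \<le> exp (- (1 + \<delta> n) * Signal n (K n) \<beta> (a n) (b n)
                     + tstar n (a n) (b n) * sstar n (K n) C (a n) (b n) (\<epsilon> n) C0 C1 \<alpha>)
                + \<alpha>
                + exp (- c0 * Signal n (K n) \<beta> (a n) (b n))
                + exp (- c1 * (a n + ln (real n)))))))) \<and>
    (\<forall>c3>0. \<exists>L1>0. \<exists>L2>0. \<exists>L3>0. \<exists>c4>0.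
      \<forall>K a b \<epsilon> C w0. admissible \<beta> \<rho>m \<rho>p Cs K a b C w0 \<longrightarrow>
      (\<exists>\<delta>. \<delta> \<longlonglongrightarrow> 0 \<and>
        (\<forall>\<^sub>F n in sequentially.
          gamma0 n (K n) C (a n) (b n) (\<epsilon> n) C0 > 0 \<and>
          eta n C (a n) (\<epsilon> n) \<ge> 2 * Bterm n (K n) (a n) (b n) C0 \<longrightarrow>
          sstar n (K n) C (a n) (b n) (\<epsilon> n) C0 C1
              (1 / (real n * real (K n)) * exp (- c3 * \<epsilon> n / 2))
            \<le> L1 * (Delta n C (a n) * (ln (real n * real (K n)) / \<epsilon> n) + Delta n C (a n)) \<and>
          (\<forall>\<sigma>0\<in>Sigma_bal n (K n) \<beta>. \<forall>M.
            is_estimator n (K n) \<beta> C w0 (a n) (b n) (\<epsilon> n) M \<longrightarrow>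
              risk n (K n) (a n) (b n) \<sigma>0 M
              \<le> exp (- (1 + \<delta> n) * Signal n (K n) \<beta> (a n) (b n)
                     + L2 * (Delta n C (a n) * (ln (real n * real (K n)) / \<epsilon> n))
                     + L3 * Delta n C (a n))
                + 1 / (real n * real (K n)) * exp (- c4 * \<epsilon> n)
                + exp (- c0 * Signal n (K n) \<beta> (a n) (b n))
                + exp (- c1 * (a n + ln (real n)))))))"
proof -
  \<comment> \<open>\<open>C1\<close> is the entropy constant 12 + 12 J with J = ln(4/\<rho>m) a
    bound on I, and \<open>H\<close> bounds n I / a. In \<open>Cs\<close>, the part 2 C1 reserves
    half of the signal for the entropy, and 4 H / \<rho>m makes a dominate ln(nK).\<close>
  define C1 where "C1 = 12 + 12 * ln (4 / \<rho>m)"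
  define H where "H = 4 + 2 * ln (4 / \<rho>m)"
  define Cs where "Cs = 2 * C1 + 4 * H / \<rho>m"
  have "\<rho>m < 1" using assms by linarith
  then have "0 \<le> ln (4 / \<rho>m)" using assms by simp
  then have C1: "12 \<le> C1" and H: "4 \<le> H" by (simp_all add: C1_def H_def)
  have H\<rho>: "0 < H / \<rho>m" using H assms by simp
  then have Cs: "0 < Cs" using C1 by (simp add: Cs_def add_pos_pos)
  have Cs_ge: "2 * C1 \<le> Cs" "4 * H / \<rho>m \<le> Cs"
    using C1 H assms(2) by (simp_all add: Cs_def)
  show ?thesis
  \<comment> \<open>The witness c1 = 10 is the exponent in the definition of the envelope
    constant.\<close>
  proof (rule exI[of _ Cs], intro conjI Cs, rule exI[of _ "1/4"], intro conjI, simp,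
      rule exI[of _ 10], intro conjI, simp, rule exI[of _ 1], intro conjI, simp,
      rule exI[of _ C1], intro conjI allI impI)
    show "0 < C1" using C1 by simp
  next
    fix K a b \<epsilon> C w0 assume adm: "admissible \<beta> \<rho>m \<rho>p Cs K a b C w0"
    have w0: "w0 \<in> {0..1}" using adm by (simp add: admissible_def)
    show "\<exists>\<delta>. \<delta> \<longlonglongrightarrow> 0 \<and>
        (\<forall>\<^sub>F n in sequentially.
          gamma0 n (K n) C (a n) (b n) (\<epsilon> n) 1 > 0 \<longrightarrow>
          (\<forall>\<sigma>0\<in>Sigma_bal n (K n) \<beta>. \<forall>M.
            is_estimator n (K n) \<beta> C w0 (a n) (b n) (\<epsilon> n) M \<longrightarrow>
            (\<forall>\<alpha>. 0 < \<alpha> \<and> \<alpha> < 1 / 2 \<longrightarrow>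
              risk n (K n) (a n) (b n) \<sigma>0 M
              \<le> exp (- (1 + \<delta> n) * Signal n (K n) \<beta> (a n) (b n)
                     + tstar n (a n) (b n) * sstar n (K n) C (a n) (b n) (\<epsilon> n) 1 C1 \<alpha>)
                + \<alpha>
                + exp (- (1/4) * Signal n (K n) \<beta> (a n) (b n))
                + exp (- 10 * (a n + ln (real n))))))"
    proof (rule exI[of _ "\<lambda>_. 0"], intro conjI tendsto_const)
      show "\<forall>\<^sub>F n in sequentially.
          gamma0 n (K n) C (a n) (b n) (\<epsilon> n) 1 > 0 \<longrightarrow>
          (\<forall>\<sigma>0\<in>Sigma_bal n (K n) \<beta>. \<forall>M.
            is_estimator n (K n) \<beta> C w0 (a n) (b n) (\<epsilon> n) M \<longrightarrow>
            (\<forall>\<alpha>. 0 < \<alpha> \<and> \<alpha> < 1 / 2 \<longrightarrow>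
              risk n (K n) (a n) (b n) \<sigma>0 M
              \<le> exp (- (1 + 0) * Signal n (K n) \<beta> (a n) (b n)
                     + tstar n (a n) (b n) * sstar n (K n) C (a n) (b n) (\<epsilon> n) 1 C1 \<alpha>)
                + \<alpha>
                + exp (- (1/4) * Signal n (K n) \<beta> (a n) (b n))
                + exp (- 10 * (a n + ln (real n)))))"
        using admissible_eventually[OF adm assms(2) Cs assms(1)]
      proof eventually_elim
        case (elim n)
        let ?l = "ln (real n * real (K n))"
        show ?case
        proof (intro impI ballI allI)
          fix \<sigma>0 M and \<alpha> :: real
          assume *: "gamma0 n (K n) C (a n) (b n) (\<epsilon> n) 1 > 0" "\<sigma>0 \<in> Sigma_bal n (K n) \<beta>"
            "is_estimator n (K n) \<beta> C w0 (a n) (b n) (\<epsilon> n) M" "0 < \<alpha> \<and> \<alpha> < 1 / 2"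
          have "2 * C1 * ?l \<le> Cs * ?l"
            using Cs_ge(1) by (rule mult_right_mono) (use elim in linarith)
          then have S: "2 * C1 * ?l \<le> Signal n (K n) \<beta> (a n) (b n)" using elim by linarith
          have env: "measure_pmf.prob (sbm n (a n) (b n) \<sigma>0) (envelope n C (a n)) \<ge> 1 - exp (- 10 * (a n + ln (real n)))"
            using adm elim *(2) by (auto simp: admissible_def envelope_constant_def)
          have "risk n (K n) (a n) (b n) \<sigma>0 M
              \<le> exp (- Signal n (K n) \<beta> (a n) (b n)
                     + tstar n (a n) (b n) * sstar n (K n) C (a n) (b n) (\<epsilon> n) 1 C1 \<alpha>)
                + \<alpha>
                + exp (- (1/4) * Signal n (K n) \<beta> (a n) (b n))
                + exp (- 10 * (a n + ln (real n)))"
            using elim * C1 S assms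
            by (intro private_risk_le[OF _ _ _ assms(2) _ _ _ _ assms(1) w0 *(3,2) env]) (auto simp: C1_def)
          then show "risk n (K n) (a n) (b n) \<sigma>0 M
              \<le> exp (- (1 + 0) * Signal n (K n) \<beta> (a n) (b n)
                     + tstar n (a n) (b n) * sstar n (K n) C (a n) (b n) (\<epsilon> n) 1 C1 \<alpha>)
                + \<alpha>
                + exp (- (1/4) * Signal n (K n) \<beta> (a n) (b n))
                + exp (- 10 * (a n + ln (real n)))"
            by (simp only: add_0_right mult_minus1)
        qed
      qed
    qed
  next
    fix c3 :: real assume c3: "0 < c3"
    let ?L1 = "8 * (C1 + 4) + 4 * c3"
    show "\<exists>L1>0. \<exists>L2>0. \<exists>L3>0. \<exists>c4>0.
      \<forall>K a b \<epsilon> C w0. admissible \<beta> \<rho>m \<rho>p Cs K a b C w0 \<longrightarrow>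
      (\<exists>\<delta>. \<delta> \<longlonglongrightarrow> 0 \<and>
        (\<forall>\<^sub>F n in sequentially.
          gamma0 n (K n) C (a n) (b n) (\<epsilon> n) 1 > 0 \<and>
          eta n C (a n) (\<epsilon> n) \<ge> 2 * Bterm n (K n) (a n) (b n) 1 \<longrightarrow>
          sstar n (K n) C (a n) (b n) (\<epsilon> n) 1 C1
              (1 / (real n * real (K n)) * exp (- c3 * \<epsilon> n / 2))
            \<le> L1 * (Delta n C (a n) * (ln (real n * real (K n)) / \<epsilon> n) + Delta n C (a n)) \<and>
          (\<forall>\<sigma>0\<in>Sigma_bal n (K n) \<beta>. \<forall>M.
            is_estimator n (K n) \<beta> C w0 (a n) (b n) (\<epsilon> n) M \<longrightarrow>
              risk n (K n) (a n) (b n) \<sigma>0 M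
              \<le> exp (- (1 + \<delta> n) * Signal n (K n) \<beta> (a n) (b n)
                     + L2 * (Delta n C (a n) * (ln (real n * real (K n)) / \<epsilon> n))
                     + L3 * Delta n C (a n))
                + 1 / (real n * real (K n)) * exp (- c4 * \<epsilon> n)
                + exp (- (1/4) * Signal n (K n) \<beta> (a n) (b n))
                + exp (- 10 * (a n + ln (real n))))))"
    \<comment> \<open>With L3 = H / \<rho>m the term L3 \<Delta> already outweighs the signal, so
      the exponent is nonnegative and the bound follows from risk \<le> 1. Any positive L2 and c4
      would serve; both are taken to be 1.\<close>
    proof (rule exI[of _ ?L1], intro conjI, use C1 c3 in simp, rule exI[of _ 1], intro conjI, simp,
        rule exI[of _ "H / \<rho>m"], intro conjI H\<rho>, rule exI[of _ 1], intro conjI, simp, intro allI impI)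
      fix K a b \<epsilon> C w0 assume adm: "admissible \<beta> \<rho>m \<rho>p Cs K a b C w0"
      have C: "0 < C" using adm by (simp add: admissible_def envelope_constant_def)
      show "\<exists>\<delta>. \<delta> \<longlonglongrightarrow> 0 \<and>
        (\<forall>\<^sub>F n in sequentially.
          gamma0 n (K n) C (a n) (b n) (\<epsilon> n) 1 > 0 \<and>
          eta n C (a n) (\<epsilon> n) \<ge> 2 * Bterm n (K n) (a n) (b n) 1 \<longrightarrow>
          sstar n (K n) C (a n) (b n) (\<epsilon> n) 1 C1
              (1 / (real n * real (K n)) * exp (- c3 * \<epsilon> n / 2))
            \<le> ?L1 * (Delta n C (a n) * (ln (real n * real (K n)) / \<epsilon> n) + Delta n C (a n)) \<and>
          (\<forall>\<sigma>0\<in>Sigma_bal n (K n) \<beta>. \<forall>M.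
            is_estimator n (K n) \<beta> C w0 (a n) (b n) (\<epsilon> n) M \<longrightarrow>
              risk n (K n) (a n) (b n) \<sigma>0 M
              \<le> exp (- (1 + \<delta> n) * Signal n (K n) \<beta> (a n) (b n)
                     + 1 * (Delta n C (a n) * (ln (real n * real (K n)) / \<epsilon> n))
                     + H / \<rho>m * Delta n C (a n))
                + 1 / (real n * real (K n)) * exp (- 1 * \<epsilon> n)
                + exp (- (1/4) * Signal n (K n) \<beta> (a n) (b n))
                + exp (- 10 * (a n + ln (real n)))))"
      proof (rule exI[of _ "\<lambda>_. 0"], intro conjI tendsto_const)
        show "\<forall>\<^sub>F n in sequentially.
          gamma0 n (K n) C (a n) (b n) (\<epsilon> n) 1 > 0 \<and>
          eta n C (a n) (\<epsilon> n) \<ge> 2 * Bterm n (K n) (a n) (b n) 1 \<longrightarrow>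
          sstar n (K n) C (a n) (b n) (\<epsilon> n) 1 C1
              (1 / (real n * real (K n)) * exp (- c3 * \<epsilon> n / 2))
            \<le> ?L1 * (Delta n C (a n) * (ln (real n * real (K n)) / \<epsilon> n) + Delta n C (a n)) \<and>
          (\<forall>\<sigma>0\<in>Sigma_bal n (K n) \<beta>. \<forall>M.
            is_estimator n (K n) \<beta> C w0 (a n) (b n) (\<epsilon> n) M \<longrightarrow>
              risk n (K n) (a n) (b n) \<sigma>0 M
              \<le> exp (- (1 + 0) * Signal n (K n) \<beta> (a n) (b n)
                     + 1 * (Delta n C (a n) * (ln (real n * real (K n)) / \<epsilon> n))
                     + H / \<rho>m * Delta n C (a n))
                + 1 / (real n * real (K n)) * exp (- 1 * \<epsilon> n)
                + exp (- (1/4) * Signal n (K n) \<beta> (a n) (b n))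
                + exp (- 10 * (a n + ln (real n))))"
          using admissible_eventually[OF adm assms(2) Cs assms(1)]
        proof eventually_elim
          case (elim n)
          let ?l = "ln (real n * real (K n))"
          have \<Delta>: "0 < Delta n C (a n)" using C elim by (auto simp: Delta_def max_def)
          have B: "0 \<le> Bterm n (K n) (a n) (b n) 1" unfolding Bterm_def
            by (intro mult_nonneg_nonneg divide_nonneg_nonneg) (use elim in linarith)+
          show ?case
          proof (intro impI conjI ballI allI)
            assume *: "gamma0 n (K n) C (a n) (b n) (\<epsilon> n) 1 > 0 \<and>
              eta n C (a n) (\<epsilon> n) \<ge> 2 * Bterm n (K n) (a n) (b n) 1"
            show "sstar n (K n) C (a n) (b n) (\<epsilon> n) 1 C1 (1 / (real n * real (K n)) * exp (- c3 * \<epsilon> n / 2))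
              \<le> ?L1 * (Delta n C (a n) * (ln (real n * real (K n)) / \<epsilon> n) + Delta n C (a n))"
              using elim C1 * by (intro sstar_le(2)[OF _ _ B \<Delta> _ _ c3]) auto
            fix \<sigma>0 M assume \<sigma>: "\<sigma>0 \<in> Sigma_bal n (K n) \<beta>"
            have \<epsilon>: "0 < \<epsilon> n"
              using elim C1 * by (intro sstar_le(1)[OF _ _ B \<Delta> _ _ c3, of "\<epsilon> n" C1]) auto
            have "4 * H / \<rho>m * ?l \<le> Cs * ?l"
              using Cs_ge(2) by (rule mult_right_mono) (use elim in linarith)
            then have S: "4 * H / \<rho>m * ?l \<le> Signal n (K n) \<beta> (a n) (b n)" using elim by linarith
            have env: "measure_pmf.prob (sbm n (a n) (b n) \<sigma>0) (envelope n C (a n)) \<ge> 1 - exp (- 10 * (a n + ln (real n)))"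
              using adm elim \<sigma> by (auto simp: admissible_def envelope_constant_def)
            have "Signal n (K n) \<beta> (a n) (b n) \<le> H / \<rho>m * Delta n C (a n)"
              unfolding H_def using elim S
              by (intro Signal_le_Delta[OF _ _ _ assms(2) _ _ _ assms(1) _ _ env]) (auto simp: H_def)
            moreover have "0 \<le> Delta n C (a n) * (?l / \<epsilon> n)"
              by (intro mult_nonneg_nonneg divide_nonneg_nonneg) (use \<Delta> \<epsilon> elim in linarith)+
            ultimately have e: "0 \<le> - (1 + 0) * Signal n (K n) \<beta> (a n) (b n)
                     + 1 * (Delta n C (a n) * (?l / \<epsilon> n)) + H / \<rho>m * Delta n C (a n)"
              by simp
            have "risk n (K n) (a n) (b n) \<sigma>0 M \<le> 1" by (rule risk_le_1)
            also have "1 \<le> exp (- (1 + 0) * Signal n (K n) \<beta> (a n) (b n)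
                     + 1 * (Delta n C (a n) * (?l / \<epsilon> n)) + H / \<rho>m * Delta n C (a n))"
              using e by (simp only: one_le_exp_iff)
            finally show "risk n (K n) (a n) (b n) \<sigma>0 M
              \<le> exp (- (1 + 0) * Signal n (K n) \<beta> (a n) (b n)
                     + 1 * (Delta n C (a n) * (ln (real n * real (K n)) / \<epsilon> n))
                     + H / \<rho>m * Delta n C (a n))
                + 1 / (real n * real (K n)) * exp (- 1 * \<epsilon> n)
                + exp (- (1/4) * Signal n (K n) \<beta> (a n) (b n))
                + exp (- 10 * (a n + ln (real n)))"
              by (intro add_increasing2) auto
          qed
        qed
      qed
    qed
  qed
qed

end
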